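(* Let $\beta=1$ and $0<\zeta/\alpha<2$. Let $u$ be a vertex of $\mathcal{G}(N;\zeta,\alpha,\beta)$ with type $t_u\le \zeta R/(2\alpha)$. Then for any $\varepsilon>0$, conditionally on $t_u$, $$D_u\stackrel{\Delta}{=}(1\pm\varepsilon)\,\mathsf{Bin}\left(N-1,\ (R-t_u)\frac{K e^{\zeta t_u/2}}{N}\right),$$ where $K=\frac{1}{\pi}\cdot\frac{2\alpha\zeta}{2\alpha-\zeta}$.
   Context: Model $\mathcal{G}(N;\zeta,\alpha,\beta)$: fix $0<\zeta<2$, $\alpha>0$, $\beta>0$. For a positive integer $N$ let $R$ be defined by $N=e^{\zeta R/2}$. Work in the native representation of the hyperbolic plane of curvature $-\zeta^2$: points of $\mathbb{R}^2$ in polar coordinates $(r,\theta)$, where $r$ is the hyperbolic distance from the origin, and the hyperbolic distance between $u=(r_u,\theta_u)$, $v=(r_v,\theta_v)$ is given by $\cosh(\zeta d(u,v))=\cosh(\zeta r_u)\cosh(\zeta r_v)-\sinh(\zeta r_u)\sinh(\zeta r_v)\cos(\theta_{u,v})$, $\theta_{u,v}\in[0,\pi]$ the relative angle. The vertex set consists of $N$ independent random points in the disc of radius $R$ about the origin, each with angle uniform on $(0,2\pi]$ and, independently, radius with density $\rho(r)=\alpha\frac{\sinh(\alpha r)}{\cosh(\alpha R)-1}$ on $[0,R]$. Given the positions, each pair of distinct vertices $u,v$ is joined independently with probability $p_{u,v}=\frac{1}{\exp\left(\beta\frac{\zeta}{2}(d(u,v)-R)\right)+1}$. $D_u$ is the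 degree of $u$. The type of a vertex $v$ at distance $r_v$ from the origin is $t_v=R-r_v$. For a random variable $X$, $X\stackrel{\Delta}{=}(1\pm\varepsilon)\mathsf{Bin}(n,p)$ means that the distribution of $X$ is stochastically between $\mathsf{Bin}(n,(1-\varepsilon)p)$ and $\mathsf{Bin}(n,(1+\varepsilon)p)$ (here asymptotically, for $N$ large). *)

theory Defs
  imports "HOL-Probability.Probability"
begin

text \<open>The radius \<open>R\<close> with \<open>N = exp (\<zeta> R / 2)\<close>.\<close>

definition disc_radius :: "real \<Rightarrow> nat \<Rightarrow> real" where
  "disc_radius \<zeta> N = 2 * ln (real N) / \<zeta>"

text \<open>A point is a pair (radius, angle), with angles in \<open>(0, 2\<pi>]\<close>.\<close>

definition relative_angle :: "real \<Rightarrow> real \<Rightarrow> real" where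
  "relative_angle \<theta> \<phi> = min \<bar>\<theta> - \<phi>\<bar> (2 * pi - \<bar>\<theta> - \<phi>\<bar>)"

definition hyp_dist :: "real \<Rightarrow> real \<times> real \<Rightarrow> real \<times> real \<Rightarrow> real" where
  "hyp_dist \<zeta> p q =
     arcosh (cosh (\<zeta> * fst p) * cosh (\<zeta> * fst q)
       - sinh (\<zeta> * fst p) * sinh (\<zeta> * fst q) * cos (relative_angle (snd p) (snd q))) / \<zeta>"

definition radial_measure :: "real \<Rightarrow> real \<Rightarrow> real measure" where
  "radial_measure \<alpha> R =
     density lborel
       (\<lambda>r. ennreal (indicator {0..R} r * (\<alpha> * sinh (\<alpha> * r) / (cosh (\<alpha> * R) - 1))))"

definition angle_measure :: "real measure" where
  "angle_measure = uniform_measure lborel {0<..2 * pi}"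

definition point_law :: "real \<Rightarrow> real \<Rightarrow> (real \<times> real) measure" where
  "point_law \<alpha> R = radial_measure \<alpha> R \<Otimes>\<^sub>M angle_measure"

definition positions :: "nat \<Rightarrow> real \<Rightarrow> real \<Rightarrow> (nat \<Rightarrow> real \<times> real) measure" where
  "positions N \<zeta> \<alpha> = PiM {..<N} (\<lambda>_. point_law \<alpha> (disc_radius \<zeta> N))"

definition connection_prob ::
    "nat \<Rightarrow> real \<Rightarrow> real \<Rightarrow> real \<times> real \<Rightarrow> real \<times> real \<Rightarrow> real" where
  "connection_prob N \<zeta> \<beta> p q =
     1 / (exp (\<beta> * (\<zeta> / 2) * (hyp_dist \<zeta> p q - disc_radius \<zeta> N)) + 1)"

text \<open>The unordered pair of distinct vertices \<open>{i, j}\<close> is represented by \<open>(i, j)\<close> with \<open>i < j\<close>;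
  a graph is the indicator function of its set of edges.\<close>

definition vertex_pairs :: "nat \<Rightarrow> (nat \<times> nat) set" where
  "vertex_pairs N = {(i, j). i < j \<and> j < N}"

definition edges_given_positions ::
    "nat \<Rightarrow> real \<Rightarrow> real \<Rightarrow> (nat \<Rightarrow> real \<times> real) \<Rightarrow> (nat \<times> nat \<Rightarrow> bool) pmf" where
  "edges_given_positions N \<zeta> \<beta> x =
     Pi_pmf (vertex_pairs N) False
       (\<lambda>(i, j). bernoulli_pmf (connection_prob N \<zeta> \<beta> (x i) (x j)))"

text \<open>The joint law of the positions \<open>x\<close> and the graph \<open>G\<close>.\<close>

definition hyp_random_graph ::
    "nat \<Rightarrow> real \<Rightarrow> real \<Rightarrow> real \<Rightarrow> ((nat \<Rightarrow> real \<times> real) \<times> (nat \<times> nat \<Rightarrow> bool)) measure" where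
  "hyp_random_graph N \<zeta> \<alpha> \<beta> =
     positions N \<zeta> \<alpha> \<bind>
       (\<lambda>x. distr (measure_pmf (edges_given_positions N \<zeta> \<beta> x))
              (positions N \<zeta> \<alpha> \<Otimes>\<^sub>M count_space UNIV) (\<lambda>G. (x, G)))"

definition vertex_type ::
    "nat \<Rightarrow> real \<Rightarrow> nat \<Rightarrow> (nat \<Rightarrow> real \<times> real) \<times> (nat \<times> nat \<Rightarrow> bool) \<Rightarrow> real" where
  "vertex_type N \<zeta> u \<omega> = disc_radius \<zeta> N - fst (fst \<omega> u)"

definition vertex_degree ::
    "nat \<Rightarrow> nat \<Rightarrow> (nat \<Rightarrow> real \<times> real) \<times> (nat \<times> nat \<Rightarrow> bool) \<Rightarrow> nat" where
  "vertex_degree N u \<omega> = card {v. v < N \<and> v \<noteq> u \<and> snd \<omega> (min u v, max u v)}"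

text \<open>The conditional probability of \<open>D\<^sub>u \<ge> k\<close> given (the sigma-algebra generated by) \<open>t\<^sub>u\<close>.\<close>

definition degree_tail_given_type ::
    "nat \<Rightarrow> real \<Rightarrow> real \<Rightarrow> real \<Rightarrow> nat \<Rightarrow>
      (nat \<Rightarrow> real \<times> real) \<times> (nat \<times> nat \<Rightarrow> bool) \<Rightarrow> nat \<Rightarrow> real" where
  "degree_tail_given_type N \<zeta> \<alpha> \<beta> u \<omega> k =
     (let M = hyp_random_graph N \<zeta> \<alpha> \<beta> in
        real_cond_exp M (vimage_algebra (space M) (vertex_type N \<zeta> u) borel)
          (indicator {\<omega> \<in> space M. k \<le> vertex_degree N u \<omega>}) \<omega>)"

text \<open>The law with upper tails \<open>T k = P(X \<ge> k)\<close> lies stochastically between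
  \<open>Bin(n, (1 - \<epsilon>) p)\<close> and \<open>Bin(n, (1 + \<epsilon>) p)\<close>. The upper parameter is required to be a
  probability; for \<open>\<epsilon> > 1\<close> the negative lower parameter is read as \<open>0\<close>.\<close>

definition approx_binomial :: "(nat \<Rightarrow> real) \<Rightarrow> real \<Rightarrow> nat \<Rightarrow> real \<Rightarrow> bool" where
  "approx_binomial T \<epsilon> n p \<longleftrightarrow>
     0 \<le> p \<and> (1 + \<epsilon>) * p \<le> 1 \<and>
     (\<forall>k. measure_pmf.prob (binomial_pmf n (max 0 ((1 - \<epsilon>) * p))) {k..} \<le> T k \<and>
          T k \<le> measure_pmf.prob (binomial_pmf n ((1 + \<epsilon>) * p)) {k..})"

text \<open>Well-definedness: the law of the edges is a probability kernel of the positions, so the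
  monadic bind above is the intended mixture, and \<open>t\<^sub>u\<close> is a random variable.\<close>

lemma finite_vertex_pairs: "finite (vertex_pairs N)"
  by (rule finite_subset[of _ "{..<N} \<times> {..<N}"]) (auto simp: vertex_pairs_def)

lemma sets_point_law [measurable_cong]:
  "sets (point_law \<alpha> R) = sets (borel \<Otimes>\<^sub>M borel)"
  unfolding point_law_def
  by (rule sets_pair_measure_cong) (simp_all add: radial_measure_def angle_measure_def)

lemma measurable_position:
  assumes "k < N"
  shows "(\<lambda>x. x k) \<in> positions N \<zeta> \<alpha> \<rightarrow>\<^sub>M borel \<Otimes>\<^sub>M borel"
proof -
  have "(\<lambda>x. x k) \<in> positions N \<zeta> \<alpha> \<rightarrow>\<^sub>M point_law \<alpha> (disc_radius \<zeta> N)"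
    unfolding positions_def using assms by (intro measurable_component_singleton) simp
  then show ?thesis
    using measurable_cong_sets[OF refl sets_point_law] by blast
qed

lemma borel_measurable_connection_prob [measurable]:
  "case_prod (connection_prob N \<zeta> \<beta>) \<in>
     borel_measurable ((borel \<Otimes>\<^sub>M borel) \<Otimes>\<^sub>M (borel \<Otimes>\<^sub>M borel))"
  unfolding connection_prob_def hyp_dist_def relative_angle_def arcosh_def cosh_def sinh_def
  by measurable

lemma connection_prob_bounds: "0 \<le> connection_prob N \<zeta> \<beta> p q" "connection_prob N \<zeta> \<beta> p q \<le> 1"
  by (auto simp: connection_prob_def field_simps add_pos_pos less_imp_le)

lemma measurable_connection_positions:
  assumes "i < N" "j < N"
  shows "(\<lambda>x. connection_prob N \<zeta> \<beta> (x i) (x j)) \<in> borel_measurable (positions N \<zeta> \<alpha>)"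
proof -
  note [measurable] = measurable_position[OF assms(1)] measurable_position[OF assms(2)]
  have "(\<lambda>x. (x i, x j)) \<in> positions N \<zeta> \<alpha> \<rightarrow>\<^sub>M (borel \<Otimes>\<^sub>M borel) \<Otimes>\<^sub>M (borel \<Otimes>\<^sub>M borel)"
    by measurable
  from measurable_compose[OF this borel_measurable_connection_prob] show ?thesis by simp
qed

lemma measurable_edges_given_positions:
  "(\<lambda>x. measure_pmf (edges_given_positions N \<zeta> \<beta> x)) \<in>
     positions N \<zeta> \<alpha> \<rightarrow>\<^sub>M prob_algebra (count_space UNIV)"
proof (intro measurable_prob_algebraI measurable_subprob_algebra)
  fix A :: "(nat \<times> nat \<Rightarrow> bool) set"
  define F where "F = PiE_dflt (vertex_pairs N) False (\<lambda>_. UNIV :: bool set)"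
  have F: "finite F"
    unfolding F_def by (intro finite_PiE_dflt finite_vertex_pairs) auto
  have pmf_meas: "(\<lambda>x. pmf (edges_given_positions N \<zeta> \<beta> x) G) \<in> borel_measurable (positions N \<zeta> \<alpha>)"
    for G
  proof -
    have "(\<lambda>x. \<Prod>e\<in>vertex_pairs N. pmf (case e of (i, j) \<Rightarrow>
        bernoulli_pmf (connection_prob N \<zeta> \<beta> (x i) (x j))) (G e)) \<in> borel_measurable (positions N \<zeta> \<alpha>)"
    proof (rule borel_measurable_prod)
      fix e assume "e \<in> vertex_pairs N"
      then obtain i j where e: "e = (i, j)" and ij: "i < N" "j < N"
        by (auto simp: vertex_pairs_def)
      note [measurable] = measurable_connection_positions[OF ij]
      show "(\<lambda>x. pmf (case e of (i, j) \<Rightarrow>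
          bernoulli_pmf (connection_prob N \<zeta> \<beta> (x i) (x j))) (G e)) \<in> borel_measurable (positions N \<zeta> \<alpha>)"
        by (cases "G e") (simp_all add: e connection_prob_bounds)
    qed
    then show ?thesis
      by (auto simp: edges_given_positions_def pmf_Pi finite_vertex_pairs)
  qed
  have "emeasure (measure_pmf (edges_given_positions N \<zeta> \<beta> x)) A =
      ennreal (\<Sum>G\<in>A \<inter> F. pmf (edges_given_positions N \<zeta> \<beta> x) G)" for x
  proof -
    have "set_pmf (edges_given_positions N \<zeta> \<beta> x) \<subseteq> F"
      unfolding edges_given_positions_def F_def
      by (rule order_trans[OF set_Pi_pmf_subset[OF finite_vertex_pairs]]) (auto simp: PiE_dflt_def)
    then have "A \<inter> F \<inter> set_pmf (edges_given_positions N \<zeta> \<beta> x) =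
        A \<inter> set_pmf (edges_given_positions N \<zeta> \<beta> x)" by auto
    then have "measure_pmf.prob (edges_given_positions N \<zeta> \<beta> x) A =
        measure_pmf.prob (edges_given_positions N \<zeta> \<beta> x) (A \<inter> F)"
      by (metis measure_Int_set_pmf)
    then show ?thesis
      using F by (simp add: measure_pmf.emeasure_eq_measure measure_measure_pmf_finite)
  qed
  then show "(\<lambda>x. emeasure (measure_pmf (edges_given_positions N \<zeta> \<beta> x)) A) \<in>
      borel_measurable (positions N \<zeta> \<alpha>)"
    using pmf_meas by simp
qed (auto simp: prob_space_measure_pmf intro: prob_space_imp_subprob_space)

lemma measurable_graph_kernel:
  "(\<lambda>x. distr (measure_pmf (edges_given_positions N \<zeta> \<beta> x))
      (positions N \<zeta> \<alpha> \<Otimes>\<^sub>M count_space UNIV) (\<lambda>G. (x, G))) \<in>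
     positions N \<zeta> \<alpha> \<rightarrow>\<^sub>M prob_algebra (positions N \<zeta> \<alpha> \<Otimes>\<^sub>M count_space UNIV)"
  by (rule measurable_distr_prob_space2[OF measurable_edges_given_positions]) simp

lemma prob_space_radial_measure:
  assumes "0 < \<alpha>" "0 < R"
  shows "prob_space (radial_measure \<alpha> R)"
proof
  have c: "cosh (\<alpha> * R) - 1 > 0"
    using cosh_real_strict_mono[of 0 "\<alpha> * R"] assms by simp
  have "(\<integral>\<^sup>+ r. ennreal (\<alpha> * sinh (\<alpha> * r) / (cosh (\<alpha> * R) - 1)) * indicator {0..R} r \<partial>lborel) =
      ennreal (cosh (\<alpha> * R) / (cosh (\<alpha> * R) - 1) - cosh (\<alpha> * 0) / (cosh (\<alpha> * R) - 1))"
  proof (rule nn_integral_FTC_Icc[where F = "\<lambda>r. cosh (\<alpha> * r) / (cosh (\<alpha> * R) - 1)"])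
    show "(\<lambda>r. \<alpha> * sinh (\<alpha> * r) / (cosh (\<alpha> * R) - 1)) \<in> borel_measurable borel"
      unfolding sinh_def by measurable
  next
    fix r assume r: "r \<in> {0..R}"
    show "((\<lambda>r. cosh (\<alpha> * r) / (cosh (\<alpha> * R) - 1)) has_real_derivative
        \<alpha> * sinh (\<alpha> * r) / (cosh (\<alpha> * R) - 1)) (at r)"
      using c by (auto intro!: derivative_eq_intros)
    show "0 \<le> \<alpha> * sinh (\<alpha> * r) / (cosh (\<alpha> * R) - 1)"
      using c assms r by simp
  qed (use assms in auto)
  also have "\<dots> = 1"
    using c assms by (simp add: diff_divide_distrib[symmetric])
  also have "(\<integral>\<^sup>+ r. ennreal (\<alpha> * sinh (\<alpha> * r) / (cosh (\<alpha> * R) - 1)) * indicator {0..R} r \<partial>lborel) =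
      (\<integral>\<^sup>+ r. ennreal (indicator {0..R} r * (\<alpha> * sinh (\<alpha> * r) / (cosh (\<alpha> * R) - 1))) \<partial>lborel)"
    by (intro nn_integral_cong) (auto simp: indicator_def)
  finally have "(\<integral>\<^sup>+ r. ennreal (indicator {0..R} r * (\<alpha> * sinh (\<alpha> * r) / (cosh (\<alpha> * R) - 1))) \<partial>lborel) = 1" .
  moreover have "(\<lambda>r. ennreal (indicator {0..R} r * (\<alpha> * sinh (\<alpha> * r) / (cosh (\<alpha> * R) - 1))))
      \<in> borel_measurable lborel"
    unfolding sinh_def by measurable
  ultimately show "emeasure (radial_measure \<alpha> R) (space (radial_measure \<alpha> R)) = 1"
    by (simp add: radial_measure_def emeasure_density)
qed

lemma prob_space_angle_measure: "prob_space angle_measure"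
  unfolding angle_measure_def by (rule prob_space_uniform_measure) simp_all

lemma prob_space_positions:
  assumes "0 < \<zeta>" "0 < \<alpha>" "2 \<le> N"
  shows "prob_space (positions N \<zeta> \<alpha>)"
  unfolding positions_def
proof (rule prob_space_PiM)
  have "0 < disc_radius \<zeta> N"
    using assms by (simp add: disc_radius_def)
  then interpret r: prob_space "radial_measure \<alpha> (disc_radius \<zeta> N)"
    using assms by (intro prob_space_radial_measure)
  interpret a: prob_space angle_measure
    by (rule prob_space_angle_measure)
  interpret pair_prob_space "radial_measure \<alpha> (disc_radius \<zeta> N)" angle_measure ..
  show "prob_space (point_law \<alpha> (disc_radius \<zeta> N))"
    unfolding point_law_def by unfold_locales
qed

lemma
  assumes "0 < \<zeta>" "0 < \<alpha>" "2 \<le> N"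
  shows prob_space_hyp_random_graph: "prob_space (hyp_random_graph N \<zeta> \<alpha> \<beta>)"
    and sets_hyp_random_graph:
      "sets (hyp_random_graph N \<zeta> \<alpha> \<beta>) = sets (positions N \<zeta> \<alpha> \<Otimes>\<^sub>M count_space UNIV)"
proof -
  have "positions N \<zeta> \<alpha> \<in> space (prob_algebra (positions N \<zeta> \<alpha>))"
    using prob_space_positions[OF assms] by (simp add: space_prob_algebra)
  then show "prob_space (hyp_random_graph N \<zeta> \<alpha> \<beta>)"
    and "sets (hyp_random_graph N \<zeta> \<alpha> \<beta>) = sets (positions N \<zeta> \<alpha> \<Otimes>\<^sub>M count_space UNIV)"
    unfolding hyp_random_graph_def
    by (rule prob_space_bind'[OF _ measurable_graph_kernel],
        rule sets_bind'[OF _ measurable_graph_kernel])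
qed

lemma borel_measurable_vertex_type:
  assumes "0 < \<zeta>" "0 < \<alpha>" "2 \<le> N" "u < N"
  shows "vertex_type N \<zeta> u \<in> borel_measurable (hyp_random_graph N \<zeta> \<alpha> \<beta>)"
proof -
  note [measurable] = measurable_position[OF assms(4)]
  have [measurable]: "(\<lambda>x. fst (x u)) \<in> borel_measurable (positions N \<zeta> \<alpha>)"
    by measurable
  have "vertex_type N \<zeta> u \<in> borel_measurable (positions N \<zeta> \<alpha> \<Otimes>\<^sub>M count_space UNIV)"
    unfolding vertex_type_def by measurable
  then show ?thesis
    by (subst measurable_cong_sets[OF sets_hyp_random_graph[OF assms(1-3)] refl])
qed

end

theory Submission
  imports Defs "HOL-Real_Asymp.Real_Asymp"
begin

text \<open>
  Given the position of \<open>u\<close>, the other vertices are joined to \<open>u\<close> independently and with the same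
  probability \<open>m\<close>, which depends only on the radius \<open>r = R - t\<^sub>u\<close>; hence \<open>D\<^sub>u\<close> is exactly
  \<open>Bin(N - 1, m(r))\<close>. As binomial tails increase with the success probability, it remains to show
  \<open>m(r) \<sim> K r exp(-\<zeta> r / 2)\<close> uniformly in \<open>r \<ge> (1 - \<zeta> / (2 \<alpha>)) R\<close>. For a second vertex of type
  \<open>t\<close> at relative angle \<open>\<psi>\<close>, put \<open>B = exp(\<zeta> (r - t) / 2)\<close>. Then \<open>exp(\<zeta> (d - R) / 2)\<close> lies between
  \<open>B sin(\<psi> / 2)\<close> and \<open>B sin(\<psi> / 2) + 2\<close>, and since \<open>\<bar>cos\<bar> \<le> 1 \<le> \<bar>cos\<bar> + \<bar>sin\<bar>\<close>, the angular average
  of the connection probability is \<open>2 / (\<pi> B) (ln B + O(1))\<close>. Averaging \<open>1 / B\<close> over the type brings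
  in \<open>E[exp(\<zeta> t / 2)] \<longrightarrow> \<alpha> / (\<alpha> - \<zeta> / 2)\<close>, which is finite because \<open>\<zeta> < 2 \<alpha>\<close>.
\<close>

section \<open>The connection probability\<close>

text \<open>Folding the difference into a relative angle changes it only by a sign and a full turn,
  which cosine ignores; from here on plain differences of angles are used.\<close>

lemma cos_relative_angle: "cos (relative_angle \<theta> \<phi>) = cos (\<theta> - \<phi>)"
  by (simp add: relative_angle_def min_def cos_diff)

text \<open>Exhibits twice the argument of \<open>arcosh\<close> as a convex combination, weighted
  by the squared sine of the half angle, of its values at opposite and at equal angles. All terms
  are nonnegative, so no cancellation has to be controlled.\<close>

lemma cosh_law_of_cosines_half_angle:
  fixes x y \<psi> :: real
  shows "2 * (cosh x * cosh y - sinh x * sinh y * cos \<psi>) =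
    (sin (\<psi> / 2))\<^sup>2 * (exp (x + y) + exp (- (x + y))) +
    (1 - (sin (\<psi> / 2))\<^sup>2) * (exp (x - y) + exp (- (x - y)))"
proof -
  have c: "cos \<psi> = 1 - 2 * (sin (\<psi> / 2))\<^sup>2"
    using cos_double_sin[of "\<psi> / 2"] by simp
  have e: "cosh (x + y) = cosh x * cosh y + sinh x * sinh y"
    "cosh (x - y) = cosh x * cosh y - sinh x * sinh y"
    by (simp_all add: cosh_add cosh_diff)
  have e': "exp (x + y) + exp (- (x + y)) = 2 * cosh (x + y)"
    "exp (x - y) + exp (- (x - y)) = 2 * cosh (x - y)"
    by (simp_all add: cosh_def)
  show ?thesis unfolding e' e c by algebra
qed

lemma two_le_add_inverse:
  fixes x :: real
  assumes "0 < x"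
  shows "2 \<le> x + 1 / x"
  using assms zero_le_power2[of "x - 1"] by (simp add: field_simps power2_eq_square)

text \<open>The lower bound holds because \<open>exp D\<close> dominates the same convex combination
  \<open>E\<close> of \<open>exp (x + y)\<close> and \<open>exp (x - y)\<close>, of which only the
  first part is kept. The upper bound starts from \<open>exp D \<le> 2 * cosh D\<close> and bounds
  the root of a sum of squares by the sum of the roots.\<close>

lemma exp_arcosh_bounds:
  fixes x y \<psi> :: real
  assumes "0 \<le> x" "0 \<le> y"
  defines "D \<equiv> arcosh (cosh x * cosh y - sinh x * sinh y * cos \<psi>)"
  shows "exp ((x + y) / 2) * \<bar>sin (\<psi> / 2)\<bar> \<le> exp (D / 2)"
    and "exp (D / 2) \<le> exp ((x + y) / 2) * \<bar>sin (\<psi> / 2)\<bar> + exp ((x - y) / 2) + exp ((y - x) / 2)"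
proof -
  define c where "c = cosh x * cosh y - sinh x * sinh y * cos \<psi>"
  define S where "S = (sin (\<psi> / 2))\<^sup>2"
  define a where "a = exp (x + y)"
  define b where "b = exp (x - y)"
  have S: "0 \<le> S" "S \<le> 1"
    unfolding S_def using abs_sin_le_one[of "\<psi> / 2"] by (auto simp: abs_square_le_1)
  have a: "a > 0" and b: "b > 0" and a1: "1 \<le> a"
    using assms by (auto simp: a_def b_def)
  have c2: "2 * c = S * (a + 1 / a) + (1 - S) * (b + 1 / b)"
    unfolding c_def S_def a_def b_def cosh_law_of_cosines_half_angle exp_minus inverse_eq_divide ..
  have a2: "a + 1 / a \<ge> 2" and b2: "b + 1 / b \<ge> 2"
    using two_le_add_inverse a b by auto
  have "2 * c \<ge> S * 2 + (1 - S) * 2"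
    unfolding c2 using S a2 b2 by (intro add_mono mult_left_mono) auto
  then have c1: "c \<ge> 1" by simp
  define X where "X = exp D"
  have D0: "D \<ge> 0" unfolding D_def c_def[symmetric] using c1 by simp
  then have X1: "X \<ge> 1" by (simp add: X_def)
  have "cosh D = c" unfolding D_def c_def[symmetric] using c1 by simp
  then have Xc: "X + 1 / X = 2 * c"
    by (simp add: cosh_def X_def exp_minus inverse_eq_divide)
  have half: "exp (z / 2) ^ 2 = exp z" for z :: real
    by (simp add: exp_double[symmetric])
  define E where "E = S * a + (1 - S) * b"
  \<comment> \<open>Convexity of the reciprocal gives \<open>E + 1/E \<le> exp D + exp (-D)\<close>.\<close>
  have EX: "E \<le> X"
  proof (rule ccontr)
    assume "\<not> E \<le> X"
    then have EX: "E > X" by simp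
    have "(S * a + (1 - S) * b) * (S / a + (1 - S) / b) =
        S\<^sup>2 + (1 - S)\<^sup>2 + S * (1 - S) * (a / b + b / a)"
      using a b by (simp add: field_simps power2_eq_square)
    moreover have "a / b + b / a \<ge> 2"
      using two_le_add_inverse[of "a / b"] a b by simp
    then have "S * (1 - S) * (a / b + b / a) \<ge> S * (1 - S) * 2"
      using S by (intro mult_left_mono) auto
    ultimately have "E * (S / a + (1 - S) / b) \<ge> 1"
      by (simp add: E_def power2_eq_square algebra_simps)
    moreover have "E * (2 * c) = E\<^sup>2 + E * (S / a + (1 - S) / b)"
      unfolding c2 E_def by (simp add: algebra_simps power2_eq_square)
    ultimately have "E * (X + 1 / X) \<ge> E\<^sup>2 + 1" using Xc by simp
    \<comment> \<open>In effect \<open>E + 1 / E \<le> X + 1 / X\<close>, which after clearing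
      denominators factors as \<open>(E - X) * (E * X - 1) \<le> 0\<close>; this fails for
      \<open>E > X \<ge> 1\<close>.\<close>
    then have "(E\<^sup>2 + 1) * X \<le> E * (X + 1 / X) * X" using X1 by (intro mult_right_mono) auto
    also have "E * (X + 1 / X) * X = E * X\<^sup>2 + E" using X1 by (simp add: field_simps power2_eq_square)
    finally have "(E - X) * (E * X - 1) \<le> 0"
      by (simp add: algebra_simps power2_eq_square)
    moreover have "E * X > 1" using EX X1
      by (metis less_le_trans le_less_trans mult_le_cancel_left1 mult.commute not_le order.asym zero_less_one)
    ultimately show False using EX by (simp add: mult_le_0_iff)
  qed
  have "(exp ((x + y) / 2) * \<bar>sin (\<psi> / 2)\<bar>)\<^sup>2 = S * a"
    by (simp add: power_mult_distrib half S_def a_def)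
  also have "\<dots> \<le> E" using S b by (simp add: E_def)
  also have "\<dots> \<le> (exp (D / 2))\<^sup>2" using EX by (simp add: half X_def)
  finally show "exp ((x + y) / 2) * \<bar>sin (\<psi> / 2)\<bar> \<le> exp (D / 2)"
    by (rule power2_le_imp_le) simp
  let ?p = "exp ((x + y) / 2) * \<bar>sin (\<psi> / 2)\<bar>" and ?q = "exp ((x - y) / 2)" and ?r = "exp ((y - x) / 2)"
  have qr: "?q * ?r = 1" by (simp add: exp_add[symmetric] add_divide_distrib[symmetric])
  have r2: "?r\<^sup>2 = 1 / b" unfolding half b_def
    by (metis exp_minus inverse_eq_divide minus_diff_eq)
  have "(exp (D / 2))\<^sup>2 \<le> 2 * c" using Xc X1 by (simp add: half X_def[symmetric])
      (smt (verit) divide_nonneg_nonneg)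
  also have "\<dots> \<le> S * a + 1 + (b + 1 / b)"
  proof -
    have "S * (1 / a) \<le> 1 * 1" using S a1 by (intro mult_mono) auto
    moreover have "(1 - S) * (b + 1 / b) \<le> 1 * (b + 1 / b)"
      using S b by (intro mult_right_mono) auto
    ultimately show ?thesis unfolding c2 by (simp add: algebra_simps)
  qed
  \<comment> \<open>By \<open>?q * ?r = 1\<close> the square of \<open>?q + ?r\<close> is
    \<open>b + 1 / b + 2\<close>, which absorbs the leftover \<open>1\<close>.\<close>
  also have "\<dots> \<le> ?p\<^sup>2 + (?q + ?r)\<^sup>2"
    using qr r2 by (simp add: power2_sum power_mult_distrib half S_def a_def b_def algebra_simps)
  also have "\<dots> \<le> (?p + (?q + ?r))\<^sup>2"
    unfolding power2_sum[of ?p "?q + ?r"] by (simp add: mult_nonneg_nonneg)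
  finally have "exp (D / 2) \<le> ?p + (?q + ?r)"
    by (rule power2_le_imp_le) (simp add: mult_nonneg_nonneg add_nonneg_nonneg)
  then show "exp (D / 2) \<le> ?p + ?q + ?r" by simp
qed

text \<open>At \<open>\<beta> = 1\<close> the denominator of the connection probability is linear in
  \<open>exp (D / 2)\<close>, so the preceding bounds transfer directly. Rescaling by
  \<open>exp (- (\<zeta> * R / 2))\<close> leaves the two extra terms of the upper bound at most
  \<open>1\<close> each, as both radii lie in \<open>[0, R]\<close>; with the \<open>1\<close> of
  the denominator this gives the \<open>3\<close>.\<close>

lemma connection_prob_sin_bounds:
  assumes "0 < \<zeta>" "0 \<le> fst p" "fst p \<le> disc_radius \<zeta> N" "0 \<le> fst q" "fst q \<le> disc_radius \<zeta> N"
  defines "B \<equiv> exp (\<zeta> / 2 * (fst p + fst q - disc_radius \<zeta> N))"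
    and "\<sigma> \<equiv> \<bar>sin ((snd p - snd q) / 2)\<bar>"
  shows "connection_prob N \<zeta> 1 p q \<le> 1 / (1 + B * \<sigma>)"
    and "1 / (3 + B * \<sigma>) \<le> connection_prob N \<zeta> 1 p q"
proof -
  define R where "R = disc_radius \<zeta> N"
  define x where "x = \<zeta> * fst p"
  define y where "y = \<zeta> * fst q"
  define D where "D = arcosh (cosh x * cosh y - sinh x * sinh y * cos (snd p - snd q))"
  have xy: "0 \<le> x" "0 \<le> y" "x \<le> \<zeta> * R" "y \<le> \<zeta> * R" using assms by (auto simp: x_def y_def R_def)
  have "hyp_dist \<zeta> p q = D / \<zeta>"
    by (simp add: hyp_dist_def D_def x_def y_def cos_relative_angle)
  then have "1 * (\<zeta> / 2) * (hyp_dist \<zeta> p q - R) = D / 2 - \<zeta> * R / 2"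
    using assms by (simp add: field_simps)
  then have cp: "connection_prob N \<zeta> 1 p q = 1 / (exp (D / 2) * exp (- (\<zeta> * R / 2)) + 1)"
    by (simp add: connection_prob_def R_def[symmetric] exp_add[symmetric])
  have B: "B = exp ((x + y) / 2) * exp (- (\<zeta> * R / 2))"
    by (simp add: B_def R_def x_def y_def exp_add[symmetric] field_simps)
  have s0: "\<sigma> \<ge> 0" by (simp add: \<sigma>_def)
  note b = exp_arcosh_bounds[OF xy(1,2), of "snd p - snd q", folded D_def \<sigma>_def]
  have "exp ((x + y) / 2) * \<sigma> * exp (- (\<zeta> * R / 2)) \<le> exp (D / 2) * exp (- (\<zeta> * R / 2))"
    using b(1) by (intro mult_right_mono) auto
  then have 1: "B * \<sigma> \<le> exp (D / 2) * exp (- (\<zeta> * R / 2))"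
    unfolding B by (simp add: mult_ac)
  show "connection_prob N \<zeta> 1 p q \<le> 1 / (1 + B * \<sigma>)"
    unfolding cp
  proof (rule divide_left_mono)
    show "1 + B * \<sigma> \<le> exp (D / 2) * exp (- (\<zeta> * R / 2)) + 1" using 1 by simp
    show "0 < (exp (D / 2) * exp (- (\<zeta> * R / 2)) + 1) * (1 + B * \<sigma>)"
      using s0 by (intro mult_pos_pos add_pos_nonneg add_nonneg_pos) (auto simp: B_def)
  qed simp
  have "exp (D / 2) * exp (- (\<zeta> * R / 2)) \<le>
      (exp ((x + y) / 2) * \<sigma> + exp ((x - y) / 2) + exp ((y - x) / 2)) * exp (- (\<zeta> * R / 2))"
    using b(2) by (intro mult_right_mono) auto
  also have "\<dots> = B * \<sigma> + exp ((x - y - \<zeta> * R) / 2) + exp ((y - x - \<zeta> * R) / 2)"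
    unfolding B distrib_right exp_add[symmetric]
    by (simp add: exp_add[symmetric] diff_divide_distrib mult_ac)
  also have "\<dots> \<le> B * \<sigma> + 1 + 1"
    using xy by (intro add_mono) auto
  finally have 2: "exp (D / 2) * exp (- (\<zeta> * R / 2)) + 1 \<le> 3 + B * \<sigma>" by simp
  show "1 / (3 + B * \<sigma>) \<le> connection_prob N \<zeta> 1 p q"
    unfolding cp
  proof (rule divide_left_mono)
    show "0 < (3 + B * \<sigma>) * (exp (D / 2) * exp (- (\<zeta> * R / 2)) + 1)"
      using s0 by (intro mult_pos_pos add_pos_nonneg add_nonneg_pos) (auto simp: B_def)
  qed (use 2 in auto)
qed

section \<open>Averaging over the angle\<close>

text \<open>Only the residue \<open>c\<close> of the shift modulo \<open>T\<close> matters. The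
  window from \<open>c\<close> to \<open>T + c\<close> is cut at \<open>T\<close> and the part
  beyond is moved back by one period.\<close>

lemma nn_integral_periodic_shift:
  fixes f :: "real \<Rightarrow> ennreal"
  assumes [measurable]: "f \<in> borel_measurable borel"
    and per: "\<And>x. f (x + T) = f x" and "0 < T"
  shows "(\<integral>\<^sup>+x. f (x + a) * indicator {0<..T} x \<partial>lborel) = (\<integral>\<^sup>+x. f x * indicator {0<..T} x \<partial>lborel)"
proof -
  have perz: "f (x + of_int n * T) = f x" for x and n :: int
  proof (induction n rule: int_induct[where k = 0])
    case (step1 i)
    then show ?case using per[of "x + of_int i * T"] by (simp add: algebra_simps)
  next
    case (step2 i)
    then show ?case using per[of "x + of_int (i - 1) * T"] by (simp add: algebra_simps)
  qed simp
  define c where "c = a - of_int \<lfloor>a / T\<rfloor> * T"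
  have c: "0 \<le> c" "c \<le> T"
  proof -
    have "of_int \<lfloor>a / T\<rfloor> * T \<le> a / T * T" using \<open>0 < T\<close> by (intro mult_right_mono) auto
    then show "0 \<le> c" using \<open>0 < T\<close> by (simp add: c_def)
    have "a / T * T \<le> (of_int \<lfloor>a / T\<rfloor> + 1) * T" using \<open>0 < T\<close> by (intro mult_right_mono) linarith+
    then show "c \<le> T" using \<open>0 < T\<close> by (simp add: c_def algebra_simps)
  qed
  have fa: "f (x + a) = f (x + c)" for x
    using perz[of "x + c" "\<lfloor>a / T\<rfloor>"] by (simp add: c_def algebra_simps)
  have "(\<integral>\<^sup>+x. f (x + a) * indicator {0<..T} x \<partial>lborel) =
      (\<integral>\<^sup>+x. f x * indicator {c<..T + c} x \<partial>lborel)"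
    unfolding fa
    by (subst nn_integral_real_affine[where c = 1 and t = "-c" and f = "\<lambda>x. f (x + c) * indicator {0<..T} x"])
       (auto intro!: nn_integral_cong simp: indicator_def)
  also have "\<dots> = (\<integral>\<^sup>+x. f x * indicator {c<..T} x + f x * indicator {T<..T + c} x \<partial>lborel)"
    using c by (intro nn_integral_cong) (auto simp: indicator_def)
  also have "\<dots> = (\<integral>\<^sup>+x. f x * indicator {c<..T} x \<partial>lborel) + (\<integral>\<^sup>+x. f x * indicator {T<..T + c} x \<partial>lborel)"
    by (rule nn_integral_add) auto
  also have "(\<integral>\<^sup>+x. f x * indicator {T<..T + c} x \<partial>lborel) = (\<integral>\<^sup>+x. f x * indicator {0<..c} x \<partial>lborel)"
    by (subst nn_integral_real_affine[where c = 1 and t = "T" and f = "\<lambda>x. f x * indicator {T<..T + c} x"])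
       (auto intro!: nn_integral_cong simp: indicator_def per add.commute[of T])
  also have "(\<integral>\<^sup>+x. f x * indicator {c<..T} x \<partial>lborel) + (\<integral>\<^sup>+x. f x * indicator {0<..c} x \<partial>lborel) =
      (\<integral>\<^sup>+x. f x * indicator {c<..T} x + f x * indicator {0<..c} x \<partial>lborel)"
    by (rule nn_integral_add[symmetric]) auto
  also have "\<dots> = (\<integral>\<^sup>+x. f x * indicator {0<..T} x \<partial>lborel)"
    using c by (intro nn_integral_cong) (auto simp: indicator_def)
  finally show ?thesis .
qed

lemma nn_integral_angle_measure:
  assumes [measurable]: "f \<in> borel_measurable borel"
  shows "(\<integral>\<^sup>+\<phi>. f \<phi> \<partial>angle_measure) = (\<integral>\<^sup>+\<phi>. f \<phi> * indicator {0<..2 * pi} \<phi> \<partial>lborel) / ennreal (2 * pi)"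
  unfolding angle_measure_def by (subst nn_integral_uniform_measure) (auto simp: ennreal_mult'')

text \<open>Evenness turns the reflection \<open>\<theta> - \<phi>\<close> into the translation
  \<open>\<phi> - \<theta>\<close>, which periodicity makes invisible.\<close>

lemma nn_integral_angle_rotate:
  fixes f :: "real \<Rightarrow> ennreal"
  assumes [measurable]: "f \<in> borel_measurable borel"
    and per: "\<And>x. f (x + 2 * pi) = f x" and even: "\<And>x. f (- x) = f x"
  shows "(\<integral>\<^sup>+\<phi>. f (\<theta> - \<phi>) \<partial>angle_measure) = (\<integral>\<^sup>+\<phi>. f \<phi> \<partial>angle_measure)"
proof -
  have "f (\<theta> - \<phi>) = f (\<phi> + (- \<theta>))" for \<phi>
    using even[of "\<theta> - \<phi>"] by simp
  then show ?thesis
    using nn_integral_periodic_shift[OF assms(1,2), of "- \<theta>"]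
    by (simp add: nn_integral_angle_measure del: add_uminus_conv_diff)
qed

lemma abs_sin_half_periodic: "\<bar>sin ((x + 2 * pi) / 2)\<bar> = \<bar>sin (x / 2)\<bar>" for x :: real
  by (simp add: add_divide_distrib)

text \<open>Up to sign and a constant, the factor \<open>cos\<close> is the derivative of the
  denominator, so the integral is a logarithm. Cosine changes sign at \<open>pi\<close>, so the two
  half turns are integrated separately with primitives \<open>F\<close> and \<open>- F\<close>; each
  contributes \<open>2 / B * ln (1 + B / m)\<close>.\<close>

lemma nn_integral_abs_cos_over_sin:
  fixes m B :: real
  assumes "0 < m" "0 < B"
  shows "(\<integral>\<^sup>+\<phi>. ennreal (\<bar>cos (\<phi> / 2)\<bar> / (m + B * \<bar>sin (\<phi> / 2)\<bar>)) * indicator {0<..2 * pi} \<phi> \<partial>lborel) =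
    ennreal (4 / B * ln (1 + B / m))"
proof -
  let ?f = "\<lambda>\<phi>. \<bar>cos (\<phi> / 2)\<bar> / (m + B * \<bar>sin (\<phi> / 2)\<bar>)"
  define F where "F = (\<lambda>\<phi>. 2 / B * ln (m + B * sin (\<phi> / 2)))"
  have s0: "sin (\<phi> / 2) \<ge> 0" if "\<phi> \<in> {0..2 * pi}" for \<phi>
    using that by (intro sin_ge_zero) auto
  have pos: "m + B * sin (\<phi> / 2) > 0" if "\<phi> \<in> {0..2 * pi}" for \<phi>
    using s0[OF that] assms by (intro add_pos_nonneg) auto
  have F: "(F has_real_derivative cos (\<phi> / 2) / (m + B * sin (\<phi> / 2))) (at \<phi>)"
    if "\<phi> \<in> {0..2 * pi}" for \<phi>
  proof -
    define w where "w = m + B * sin (\<phi> / 2)"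
    have "(F has_real_derivative 2 / B * (1 / w * (B * (cos (\<phi> / 2) * (1 / 2))))) (at \<phi>)"
      unfolding F_def w_def using pos[OF that]
      by (intro DERIV_cmult DERIV_chain2[of ln] DERIV_ln_divide) (auto intro!: derivative_eq_intros)
    then show ?thesis using assms unfolding w_def[symmetric] by simp
  qed
  have v: "F pi - F 0 = 2 / B * ln (1 + B / m)" "- F (2 * pi) - - F pi = 2 / B * ln (1 + B / m)"
  proof -
    have "ln (m + B) - ln m = ln ((m + B) / m)" using assms by (subst ln_div) auto
    also have "(m + B) / m = 1 + B / m" using assms by (simp add: field_simps)
    finally have *: "ln (m + B) - ln m = ln (1 + B / m)" .
    then show "F pi - F 0 = 2 / B * ln (1 + B / m)" "- F (2 * pi) - - F pi = 2 / B * ln (1 + B / m)"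
      unfolding *[symmetric] by (simp_all add: F_def algebra_simps)
  qed
  have 1: "(\<integral>\<^sup>+\<phi>. ennreal (?f \<phi>) * indicator {0..pi} \<phi> \<partial>lborel) = ennreal (F pi - F 0)"
  proof (rule nn_integral_FTC_Icc)
    fix \<phi> assume p: "\<phi> \<in> {0..pi}"
    then have "cos (\<phi> / 2) \<ge> 0" by (intro cos_ge_zero) auto
    then show "(F has_real_derivative ?f \<phi>) (at \<phi>)" using F[of \<phi>] s0[of \<phi>] p by simp
    show "0 \<le> ?f \<phi>" using assms by simp
  qed auto
  have 2: "(\<integral>\<^sup>+\<phi>. ennreal (?f \<phi>) * indicator {pi..2 * pi} \<phi> \<partial>lborel) = ennreal (- F (2 * pi) - - F pi)"
  proof (rule nn_integral_FTC_Icc)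
    fix \<phi> assume p: "\<phi> \<in> {pi..2 * pi}"
    have "cos (pi - \<phi> / 2) \<ge> 0" using p by (intro cos_ge_zero) auto
    then have "cos (\<phi> / 2) \<le> 0" by simp
    then show "((\<lambda>\<phi>. - F \<phi>) has_real_derivative ?f \<phi>) (at \<phi>)"
      using DERIV_minus[OF F[of \<phi>]] s0[of \<phi>] p by (simp add: abs_of_nonpos abs_of_nonneg)
    show "0 \<le> ?f \<phi>" using assms by simp
  qed auto
  \<comment> \<open>The two closed halves overlap at \<open>pi\<close> and contain \<open>0\<close>,
    a discrepancy on a null set.\<close>
  have "(\<integral>\<^sup>+\<phi>. ennreal (?f \<phi>) * indicator {0<..2 * pi} \<phi> \<partial>lborel) =
      (\<integral>\<^sup>+\<phi>. ennreal (?f \<phi>) * indicator {0..pi} \<phi> + ennreal (?f \<phi>) * indicator {pi..2 * pi} \<phi> \<partial>lborel)"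
  proof (rule nn_integral_cong_AE)
    show "AE \<phi> in lborel. ennreal (?f \<phi>) * indicator {0<..2 * pi} \<phi> =
        ennreal (?f \<phi>) * indicator {0..pi} \<phi> + ennreal (?f \<phi>) * indicator {pi..2 * pi} \<phi>"
      using AE_lborel_singleton[of 0] AE_lborel_singleton[of pi]
      by eventually_elim (use pi_gt_zero in \<open>auto simp: indicator_def\<close>)
  qed
  also have "\<dots> = (\<integral>\<^sup>+\<phi>. ennreal (?f \<phi>) * indicator {0..pi} \<phi> \<partial>lborel) +
      (\<integral>\<^sup>+\<phi>. ennreal (?f \<phi>) * indicator {pi..2 * pi} \<phi> \<partial>lborel)"
    by (rule nn_integral_add) auto
  also have "\<dots> = ennreal (2 / B * ln (1 + B / m) + 2 / B * ln (1 + B / m))"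
    unfolding 1 2 v using assms by (intro ennreal_plus[symmetric]) auto
  finally show ?thesis by simp
qed

text \<open>Multiplying by |cos| can only shrink the integrand and makes the integral elementary.
  The factor \<open>2 / pi\<close> is \<open>4\<close> over the total angle \<open>2 * pi\<close>,
  and rotation removes \<open>\<theta>\<close>.\<close>

lemma angle_average_ge:
  fixes m B :: real
  assumes "0 < m" "0 < B"
  shows "ennreal (2 / (pi * B) * ln (1 + B / m)) \<le>
    (\<integral>\<^sup>+\<phi>. ennreal (1 / (m + B * \<bar>sin ((\<theta> - \<phi>) / 2)\<bar>)) \<partial>angle_measure)"
proof -
  let ?f = "\<lambda>\<phi>. ennreal (1 / (m + B * \<bar>sin (\<phi> / 2)\<bar>))"
  have "ennreal (4 / B * ln (1 + B / m)) \<le> (\<integral>\<^sup>+\<phi>. ?f \<phi> * indicator {0<..2 * pi} \<phi> \<partial>lborel)"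
    unfolding nn_integral_abs_cos_over_sin[OF assms, symmetric]
    using assms by (intro nn_integral_mono mult_right_mono ennreal_leI divide_right_mono) auto
  then have "ennreal (4 / B * ln (1 + B / m)) / ennreal (2 * pi) \<le> (\<integral>\<^sup>+\<phi>. ?f \<phi> \<partial>angle_measure)"
    by (subst nn_integral_angle_measure) (auto intro: divide_right_mono_ennreal)
  also have "ennreal (4 / B * ln (1 + B / m)) / ennreal (2 * pi) = ennreal (2 / (pi * B) * ln (1 + B / m))"
    using assms by (subst divide_ennreal) (auto simp: field_simps)
  also have "(\<integral>\<^sup>+\<phi>. ?f \<phi> \<partial>angle_measure) = (\<integral>\<^sup>+\<phi>. ?f (\<theta> - \<phi>) \<partial>angle_measure)"
    by (rule nn_integral_angle_rotate[symmetric]) (simp_all only: abs_sin_half_periodic, auto)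
  finally show ?thesis .
qed

text \<open>Here |cos| + |sin| \<ge> 1 is inserted into the numerator. The cosine part is
  elementary; the sine part is at most \<open>1 / B\<close>, which becomes the summand
  \<open>pi / 2\<close> once \<open>2 / (pi * B)\<close> is factored out.\<close>

lemma angle_average_le:
  fixes B :: real
  assumes "0 < B"
  shows "(\<integral>\<^sup>+\<phi>. ennreal (1 / (1 + B * \<bar>sin ((\<theta> - \<phi>) / 2)\<bar>)) \<partial>angle_measure) \<le>
    ennreal (2 / (pi * B) * (ln (1 + B) + pi / 2))"
proof -
  let ?f = "\<lambda>\<phi>. ennreal (1 / (1 + B * \<bar>sin (\<phi> / 2)\<bar>))"
  have le: "1 / (1 + B * \<bar>sin \<psi>\<bar>) \<le> \<bar>cos \<psi>\<bar> / (1 + B * \<bar>sin \<psi>\<bar>) + 1 / B" for \<psi>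
  proof -
    have "1 \<le> (\<bar>cos \<psi>\<bar> + \<bar>sin \<psi>\<bar>)\<^sup>2"
      using sin_cos_squared_add[of \<psi>] by (simp add: power2_sum)
    then have "1 \<le> \<bar>cos \<psi>\<bar> + \<bar>sin \<psi>\<bar>"
      by (metis abs_ge_zero add_nonneg_nonneg one_power2 power2_le_imp_le)
    then have "1 / (1 + B * \<bar>sin \<psi>\<bar>) \<le> (\<bar>cos \<psi>\<bar> + \<bar>sin \<psi>\<bar>) / (1 + B * \<bar>sin \<psi>\<bar>)"
      using assms by (intro divide_right_mono) auto
    also have "\<dots> = \<bar>cos \<psi>\<bar> / (1 + B * \<bar>sin \<psi>\<bar>) + \<bar>sin \<psi>\<bar> / (1 + B * \<bar>sin \<psi>\<bar>)"
      by (simp add: add_divide_distrib)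
    also have "\<bar>sin \<psi>\<bar> / (1 + B * \<bar>sin \<psi>\<bar>) \<le> 1 / B"
      using assms by (simp add: divide_simps add_pos_nonneg)
    finally show ?thesis by simp
  qed
  have "(\<integral>\<^sup>+\<phi>. ?f \<phi> * indicator {0<..2 * pi} \<phi> \<partial>lborel) \<le>
      (\<integral>\<^sup>+\<phi>. ennreal (\<bar>cos (\<phi> / 2)\<bar> / (1 + B * \<bar>sin (\<phi> / 2)\<bar>)) * indicator {0<..2 * pi} \<phi> +
        ennreal (1 / B) * indicator {0<..2 * pi} \<phi> \<partial>lborel)"
    using le assms
    by (intro nn_integral_mono) (auto simp: indicator_def ennreal_plus[symmetric] simp del: ennreal_plus intro!: ennreal_leI)
  also have "\<dots> = (\<integral>\<^sup>+\<phi>. ennreal (\<bar>cos (\<phi> / 2)\<bar> / (1 + B * \<bar>sin (\<phi> / 2)\<bar>)) * indicator {0<..2 * pi} \<phi> \<partial>lborel) +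
      (\<integral>\<^sup>+\<phi>. ennreal (1 / B) * indicator {0<..2 * pi} \<phi> \<partial>lborel)"
    by (rule nn_integral_add) auto
  also have "(\<integral>\<^sup>+\<phi>. ennreal (1 / B) * indicator {0<..2 * pi} \<phi> \<partial>lborel) = ennreal (1 / B * (2 * pi))"
    using assms by (subst nn_integral_cmult) (auto simp: ennreal_mult'[symmetric])
  also have "(\<integral>\<^sup>+\<phi>. ennreal (\<bar>cos (\<phi> / 2)\<bar> / (1 + B * \<bar>sin (\<phi> / 2)\<bar>)) * indicator {0<..2 * pi} \<phi> \<partial>lborel)
      + ennreal (1 / B * (2 * pi)) = ennreal (4 / B * ln (1 + B / 1) + 1 / B * (2 * pi))"
    unfolding nn_integral_abs_cos_over_sin[OF zero_less_one assms]
    using assms by (intro ennreal_plus[symmetric]) auto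
  finally have "(\<integral>\<^sup>+\<phi>. ?f \<phi> \<partial>angle_measure) \<le> ennreal (4 / B * ln (1 + B / 1) + 1 / B * (2 * pi)) / ennreal (2 * pi)"
    by (subst nn_integral_angle_measure) (auto intro: divide_right_mono_ennreal)
  also have "\<dots> = ennreal (2 / (pi * B) * (ln (1 + B) + pi / 2))"
    using assms by (subst divide_ennreal) (auto simp: field_simps)
  also have "(\<integral>\<^sup>+\<phi>. ?f \<phi> \<partial>angle_measure) = (\<integral>\<^sup>+\<phi>. ?f (\<theta> - \<phi>) \<partial>angle_measure)"
    by (rule nn_integral_angle_rotate[symmetric]) (simp_all only: abs_sin_half_periodic, auto)
  finally show ?thesis .
qed

section \<open>Averaging over the radius\<close>

lemma sets_radial_measure [simp, measurable_cong]: "sets (radial_measure \<alpha> R) = sets borel"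
  by (simp add: radial_measure_def)

lemma sets_angle_measure [simp, measurable_cong]: "sets angle_measure = sets borel"
  by (simp add: angle_measure_def)

lemma AE_radial_measure: "AE s in radial_measure \<alpha> R. 0 \<le> s \<and> s \<le> R"
  unfolding radial_measure_def sinh_def
  by (subst AE_density) (auto simp: indicator_def)

text \<open>The moment generating function at \<open>c\<close> of the type \<open>R - s\<close> of a random vertex.\<close>

definition radial_mgf :: "real \<Rightarrow> real \<Rightarrow> real \<Rightarrow> real" where
  "radial_mgf a c R = a / (2 * (cosh (a * R) - 1)) *
     ((exp (a * R) - exp (c * R)) / (a - c) - (exp (c * R) - exp (- (a * R))) / (a + c))"

lemma nn_integral_radial_exp:
  assumes "0 < a" "0 < R" "0 < c" "c < a"
  shows "(\<integral>\<^sup>+s. ennreal (exp (c * (R - s))) \<partial>radial_measure a R) = ennreal (radial_mgf a c R)"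
proof -
  define k where "k = a / (2 * (cosh (a * R) - 1))"
  have k: "k > 0"
    using cosh_real_strict_mono[of 0 "a * R"] assms by (simp add: k_def)
  \<comment> \<open>Splitting \<open>sinh\<close> turns the integrand into two pure exponentials in
    \<open>s\<close>, whose rates \<open>a - c\<close> and \<open>a + c\<close> become the
    denominators of the primitive.\<close>
  define F where "F = (\<lambda>s. k * (exp (c * R + (a - c) * s) / (a - c) + exp (c * R - (a + c) * s) / (a + c)))"
  have "(\<integral>\<^sup>+s. ennreal (exp (c * (R - s))) \<partial>radial_measure a R) =
      (\<integral>\<^sup>+s. ennreal (k * (exp (c * R + (a - c) * s) - exp (c * R - (a + c) * s))) * indicator {0..R} s \<partial>lborel)"
  proof -
    have "a * sinh (a * s) / (cosh (a * R) - 1) * exp (c * (R - s)) =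
        k * (exp (c * R + (a - c) * s) - exp (c * R - (a + c) * s))" for s
    proof -
      have "exp (a * s) * exp (c * (R - s)) = exp (c * R + (a - c) * s)"
        "exp (- (a * s)) * exp (c * (R - s)) = exp (c * R - (a + c) * s)"
        by (simp_all add: exp_add[symmetric] algebra_simps)
      then have eq: "2 * sinh (a * s) * exp (c * (R - s)) = exp (c * R + (a - c) * s) - exp (c * R - (a + c) * s)"
        by (simp add: sinh_field_def left_diff_distrib)
      define h where "h = cosh (a * R) - 1"
      show ?thesis unfolding k_def h_def[symmetric] eq[symmetric] by simp
    qed
    then show ?thesis
      unfolding radial_measure_def
      by (subst nn_integral_density)
        (auto simp: sinh_field_def indicator_def ennreal_mult''[symmetric] intro!: nn_integral_cong)
  qed
  also have "\<dots> = ennreal (F R - F 0)"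
  proof (rule nn_integral_FTC_Icc)
    fix s assume s: "s \<in> {0..R}"
    show "(F has_real_derivative k * (exp (c * R + (a - c) * s) - exp (c * R - (a + c) * s))) (at s)"
    proof -
      have "E * (- a - c) / (a + c) = - E" for E using assms by (simp add: field_simps)
      then show ?thesis unfolding F_def using assms by (auto intro!: derivative_eq_intros)
    qed
    have "c * R - (a + c) * s \<le> c * R + (a - c) * s"
      using s assms by (simp add: algebra_simps)
    then show "0 \<le> k * (exp (c * R + (a - c) * s) - exp (c * R - (a + c) * s))"
      using k by simp
  qed (use assms in auto)
  also have "F R - F 0 = radial_mgf a c R"
  proof -
    have eq: "c * R + (a - c) * R = a * R" "c * R - (a + c) * R = - (a * R)"
      by (simp_all add: algebra_simps)
    show ?thesis
      unfolding F_def radial_mgf_def k_def[symmetric] eq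
      by (simp add: diff_divide_distrib right_diff_distrib distrib_left)
  qed
  finally show ?thesis .
qed

text \<open>In the limit the type of a random vertex is exponential with rate \<open>a\<close>, and
  \<open>a / (a - c)\<close> is the moment generating function of that law.\<close>

lemma tendsto_radial_mgf:
  assumes "0 < c" "c < a"
  shows "(radial_mgf a c \<longlongrightarrow> a / (a - c)) at_top"
proof -
  have "((\<lambda>R. a / (2 * (cosh (a * R) - 1)) *
     ((exp (a * R) - exp (c * R)) / (a - c) - (exp (c * R) - exp (- (a * R))) / (a + c)))
     \<longlongrightarrow> a / (a - c)) at_top"
    unfolding cosh_field_def using assms by (real_asymp simp: field_simps)
  then show ?thesis by (simp add: radial_mgf_def[abs_def])
qed

lemma nn_integral_point_law:
  assumes "f \<in> borel_measurable (borel \<Otimes>\<^sub>M borel)"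
  shows "(\<integral>\<^sup>+q. f q \<partial>point_law \<alpha> R) = (\<integral>\<^sup>+s. \<integral>\<^sup>+\<phi>. f (s, \<phi>) \<partial>angle_measure \<partial>radial_measure \<alpha> R)"
proof -
  interpret prob_space angle_measure by (rule prob_space_angle_measure)
  have "f \<in> borel_measurable (radial_measure \<alpha> R \<Otimes>\<^sub>M angle_measure)"
    using assms by measurable
  then show ?thesis unfolding point_law_def by (rule nn_integral_fst[symmetric])
qed

lemma measurable_connection_prob_right [measurable]:
  "connection_prob N \<zeta> \<beta> p \<in> borel_measurable (borel \<Otimes>\<^sub>M borel)"
proof -
  have "(\<lambda>q. case_prod (connection_prob N \<zeta> \<beta>) (p, q)) \<in> borel_measurable (borel \<Otimes>\<^sub>M borel)"
    by (rule measurable_Pair2[OF borel_measurable_connection_prob]) (simp add: space_pair_measure)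
  then show ?thesis by simp
qed

text \<open>For a second vertex of radius \<open>s\<close>, \<open>1 / B\<close> factors as
  \<open>exp (- (b * r)) * exp (b * (R - s))\<close>, while \<open>ln (1 + B)\<close> is at most
  \<open>b * r + 1\<close> whatever \<open>s\<close> is. So the radial average only meets the moment
  generating function at \<open>b\<close>.\<close>

lemma mean_connection_le:
  assumes "0 < \<zeta>" "0 < \<alpha>" "\<zeta> / 2 < \<alpha>" "2 \<le> N" "0 \<le> fst p" "fst p \<le> disc_radius \<zeta> N"
  shows "(\<integral>\<^sup>+q. ennreal (connection_prob N \<zeta> 1 p q) \<partial>point_law \<alpha> (disc_radius \<zeta> N)) \<le>
    ennreal (2 / pi * (\<zeta> / 2 * fst p + 3) * exp (- (\<zeta> / 2 * fst p)) * radial_mgf \<alpha> (\<zeta> / 2) (disc_radius \<zeta> N))"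
proof -
  define R where "R = disc_radius \<zeta> N"
  define b where "b = \<zeta> / 2"
  define r where "r = fst p"
  have R: "R > 0" using assms by (simp add: R_def disc_radius_def)
  have b: "0 < b" "b < \<alpha>" and r: "0 \<le> r" "r \<le> R" using assms by (auto simp: b_def r_def R_def)
  let ?k = "2 / pi * (b * r + 3) * exp (- (b * r))"
  have k: "?k \<ge> 0" using b r by simp
  have "(\<integral>\<^sup>+\<phi>. ennreal (connection_prob N \<zeta> 1 p (s, \<phi>)) \<partial>angle_measure) \<le> ennreal ?k * ennreal (exp (b * (R - s)))"
    if s: "0 \<le> s" "s \<le> R" for s
  proof -
    define B where "B = exp (b * (r + s - R))"
    have B: "B > 0" by (simp add: B_def)
    have "(\<integral>\<^sup>+\<phi>. ennreal (connection_prob N \<zeta> 1 p (s, \<phi>)) \<partial>angle_measure) \<le>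
        (\<integral>\<^sup>+\<phi>. ennreal (1 / (1 + B * \<bar>sin ((snd p - \<phi>) / 2)\<bar>)) \<partial>angle_measure)"
      using connection_prob_sin_bounds(1)[of \<zeta> p N "(s, _)"] assms s
      by (intro nn_integral_mono ennreal_leI) (auto simp: B_def r_def b_def R_def)
    also have "\<dots> \<le> ennreal (2 / (pi * B) * (ln (1 + B) + pi / 2))"
      by (rule angle_average_le[OF B])
    also have "\<dots> \<le> ennreal (?k * exp (b * (R - s)))"
    proof (rule ennreal_leI)
      have e1: "exp (b * r) \<ge> 1" using b r by simp
      have "B \<le> exp (b * r)" using s b by (simp add: B_def)
      \<comment> \<open>\<open>1 + B \<le> 2 * exp (b * r) \<le> exp (1 + b * r)\<close>; the
        remaining \<open>pi / 2\<close> is below \<open>2\<close>, whence the \<open>3\<close> of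
        the statement.\<close>
      then have "1 + B \<le> exp 1 * exp (b * r)"
        using e1 mult_right_mono[of 2 "exp 1" "exp (b * r)"] exp_ge_add_one_self[of 1] by linarith
      then have "ln (1 + B) \<le> ln (exp (1 + b * r))"
        using B by (subst ln_le_cancel_iff) (auto simp: exp_add)
      then have l: "ln (1 + B) + pi / 2 \<le> b * r + 3" using pi_less_4 by simp
      have iB: "1 / B = exp (- (b * r)) * exp (b * (R - s))"
        by (simp add: B_def exp_add[symmetric] algebra_simps inverse_eq_divide[symmetric] exp_minus[symmetric])
      have "2 / (pi * B) * (ln (1 + B) + pi / 2) = 2 / pi * (ln (1 + B) + pi / 2) * (1 / B)"
        by simp
      also have "\<dots> \<le> 2 / pi * (b * r + 3) * (1 / B)"
        using l B by (intro mult_right_mono mult_left_mono) auto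
      finally show "2 / (pi * B) * (ln (1 + B) + pi / 2) \<le> ?k * exp (b * (R - s))"
        unfolding iB by (simp add: mult_ac)
    qed
    also have "\<dots> = ennreal ?k * ennreal (exp (b * (R - s)))" using k by (intro ennreal_mult) auto
    finally show ?thesis .
  qed
  then have "(\<integral>\<^sup>+s. \<integral>\<^sup>+\<phi>. ennreal (connection_prob N \<zeta> 1 p (s, \<phi>)) \<partial>angle_measure \<partial>radial_measure \<alpha> R) \<le>
      (\<integral>\<^sup>+s. ennreal ?k * ennreal (exp (b * (R - s))) \<partial>radial_measure \<alpha> R)"
    using AE_radial_measure[where \<alpha> = \<alpha> and R = R] by (intro nn_integral_mono_AE) auto
  also have "\<dots> = ennreal ?k * ennreal (radial_mgf \<alpha> b R)"
    using assms b R by (subst nn_integral_cmult) (auto simp: nn_integral_radial_exp)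
  also have "\<dots> = ennreal (?k * radial_mgf \<alpha> b R)" by (rule ennreal_mult'[OF k, symmetric])
  finally show ?thesis
    by (subst nn_integral_point_law) (auto simp: R_def b_def r_def)
qed

text \<open>For a second vertex of type \<open>t\<close> the logarithm falls short of
  \<open>b * r\<close> by about \<open>b * t\<close>, so the average of
  \<open>t * exp (b * t)\<close> has to be bounded; the moment generating function at some
  \<open>c\<close> between \<open>b\<close> and \<open>\<alpha>\<close> dominates it. This error
  stands on the right because subtraction of extended nonnegative numbers is truncated.\<close>

lemma mean_connection_ge:
  assumes "0 < \<zeta>" "0 < \<alpha>" "\<zeta> / 2 < c" "c < \<alpha>" "2 \<le> N" "0 \<le> fst p" "fst p \<le> disc_radius \<zeta> N"
    and "2 \<le> \<zeta> / 2 * fst p"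
  shows "ennreal (2 / pi * (\<zeta> / 2 * fst p - 2) * exp (- (\<zeta> / 2 * fst p)) * radial_mgf \<alpha> (\<zeta> / 2) (disc_radius \<zeta> N)) \<le>
    (\<integral>\<^sup>+q. ennreal (connection_prob N \<zeta> 1 p q) \<partial>point_law \<alpha> (disc_radius \<zeta> N)) +
    ennreal (2 / pi * (\<zeta> / 2 / (c - \<zeta> / 2)) * exp (- (\<zeta> / 2 * fst p)) * radial_mgf \<alpha> c (disc_radius \<zeta> N))"
proof -
  define R where "R = disc_radius \<zeta> N"
  define b where "b = \<zeta> / 2"
  define r where "r = fst p"
  have R: "R > 0" using assms by (simp add: R_def disc_radius_def)
  have b: "0 < b" "b < c" "c < \<alpha>" and r: "0 \<le> r" "r \<le> R" "2 \<le> b * r"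
    using assms by (auto simp: b_def r_def R_def)
  let ?k = "2 / pi * (b * r - 2) * exp (- (b * r))"
  let ?l = "2 / pi * (b / (c - b)) * exp (- (b * r))"
  let ?J = "\<lambda>s. \<integral>\<^sup>+\<phi>. ennreal (connection_prob N \<zeta> 1 p (s, \<phi>)) \<partial>angle_measure"
  have k: "?k \<ge> 0" and l: "?l \<ge> 0" using b r by auto
  have "ennreal ?k * ennreal (exp (b * (R - s))) \<le> ?J s + ennreal ?l * ennreal (exp (c * (R - s)))"
    if s: "0 \<le> s" "s \<le> R" for s
  proof -
    define B where "B = exp (b * (r + s - R))"
    define t where "t = R - s"
    have t: "t \<ge> 0" using s by (simp add: t_def)
    have B: "B > 0" by (simp add: B_def)
    have "?k * exp (b * t) \<le> 2 / (pi * B) * ln (1 + B / 3) + ?l * exp (c * t)"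
    proof -
      \<comment> \<open>From \<open>exp 2 \<ge> 3\<close> follows \<open>ln 3 \<le> 2\<close>, the
        source of the constant \<open>2\<close>.\<close>
      have "b * (r + s - R) - 2 \<le> ln (B / 3)"
        using exp_ge_add_one_self[of "2::real"] B
        by (simp add: ln_div B_def) (metis add.commute exp_ge_add_one_self ln_exp ln_mono numeral_plus_one semiring_norm(5) zero_less_numeral)
      also have "\<dots> \<le> ln (1 + B / 3)" using B by (intro ln_mono) auto
      finally have ln: "b * r - 2 - b * t \<le> ln (1 + B / 3)" by (simp add: t_def algebra_simps)
      have iB: "1 / B = exp (- (b * r)) * exp (b * t)"
        by (simp add: B_def t_def exp_add[symmetric] algebra_simps inverse_eq_divide[symmetric] exp_minus[symmetric])
      \<comment> \<open>\<open>x \<le> exp x\<close> at \<open>x = t * (c - b)\<close> trades the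
        factor \<open>t\<close> for the larger exponent \<open>c\<close>.\<close>
      have "t * (c - b) \<le> exp (t * (c - b))"
        using exp_ge_add_one_self[of "t * (c - b)"] by linarith
      then have tt: "t \<le> exp (t * (c - b)) / (c - b)" using b by (simp add: field_simps)
      have "t * exp (b * t) \<le> exp (t * (c - b)) / (c - b) * exp (b * t)"
        using tt by (intro mult_right_mono) auto
      also have "\<dots> = exp (c * t) / (c - b)"
        by (simp add: exp_add[symmetric] algebra_simps)
      finally have tt: "t * exp (b * t) \<le> exp (c * t) / (c - b)" .
      \<comment> \<open>Here \<open>b * r - 2\<close> is split as
        \<open>(b * r - 2 - b * t) + b * t\<close>, the last summand being the error.\<close>
      have "?k * exp (b * t) = 2 / pi * (b * r - 2 - b * t) * (1 / B) + 2 / pi * b * exp (- (b * r)) * (t * exp (b * t))"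
        unfolding iB by (simp add: algebra_simps)
      also have "\<dots> \<le> 2 / pi * ln (1 + B / 3) * (1 / B) + 2 / pi * b * exp (- (b * r)) * (exp (c * t) / (c - b))"
        using ln tt b B by (intro add_mono mult_right_mono mult_left_mono) auto
      also have "\<dots> = 2 / (pi * B) * ln (1 + B / 3) + ?l * exp (c * t)" by simp
      finally show ?thesis .
    qed
    then have "ennreal (?k * exp (b * t)) \<le> ennreal (2 / (pi * B) * ln (1 + B / 3) + ?l * exp (c * t))"
      by (rule ennreal_leI)
    also have "\<dots> = ennreal (2 / (pi * B) * ln (1 + B / 3)) + ennreal (?l * exp (c * t))"
      using B mult_nonneg_nonneg[OF l, of "exp (c * t)"] by (intro ennreal_plus) auto
    also have "ennreal (2 / (pi * B) * ln (1 + B / 3)) \<le>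
        (\<integral>\<^sup>+\<phi>. ennreal (1 / (3 + B * \<bar>sin ((snd p - \<phi>) / 2)\<bar>)) \<partial>angle_measure)"
      using B by (intro angle_average_ge) auto
    also have "\<dots> \<le> ?J s"
      using connection_prob_sin_bounds(2)[of \<zeta> p N "(s, _)"] assms s
      by (intro nn_integral_mono ennreal_leI) (auto simp: B_def r_def b_def R_def)
    also have "ennreal (?k * exp (b * t)) = ennreal ?k * ennreal (exp (b * (R - s)))"
      unfolding t_def using k by (intro ennreal_mult) auto
    also have "ennreal (?l * exp (c * t)) = ennreal ?l * ennreal (exp (c * (R - s)))"
      unfolding t_def using l by (intro ennreal_mult) auto
    finally show ?thesis by (simp add: add_mono)
  qed
  then have "(\<integral>\<^sup>+s. ennreal ?k * ennreal (exp (b * (R - s))) \<partial>radial_measure \<alpha> R) \<le>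
      (\<integral>\<^sup>+s. ?J s + ennreal ?l * ennreal (exp (c * (R - s))) \<partial>radial_measure \<alpha> R)"
    using AE_radial_measure[where \<alpha> = \<alpha> and R = R] by (intro nn_integral_mono_AE) auto
  also have "\<dots> = (\<integral>\<^sup>+s. ?J s \<partial>radial_measure \<alpha> R) +
      (\<integral>\<^sup>+s. ennreal ?l * ennreal (exp (c * (R - s))) \<partial>radial_measure \<alpha> R)"
  proof (rule nn_integral_add)
    interpret prob_space angle_measure by (rule prob_space_angle_measure)
    show "?J \<in> borel_measurable (radial_measure \<alpha> R)" by measurable
  qed simp
  also have "(\<integral>\<^sup>+s. ennreal ?l * ennreal (exp (c * (R - s))) \<partial>radial_measure \<alpha> R) = ennreal ?l * ennreal (radial_mgf \<alpha> c R)"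
    using assms b R by (subst nn_integral_cmult) (auto simp: nn_integral_radial_exp)
  also have "(\<integral>\<^sup>+s. ennreal ?k * ennreal (exp (b * (R - s))) \<partial>radial_measure \<alpha> R) = ennreal ?k * ennreal (radial_mgf \<alpha> b R)"
    using assms b R by (subst nn_integral_cmult) (auto simp: nn_integral_radial_exp)
  also have "ennreal ?k * ennreal (radial_mgf \<alpha> b R) = ennreal (?k * radial_mgf \<alpha> b R)"
    by (rule ennreal_mult'[OF k, symmetric])
  also have "ennreal ?l * ennreal (radial_mgf \<alpha> c R) = ennreal (?l * radial_mgf \<alpha> c R)"
    by (rule ennreal_mult'[OF l, symmetric])
  finally show ?thesis
    by (subst nn_integral_point_law) (auto simp: R_def b_def r_def)
qed

section \<open>Binomial tails\<close>

text \<open>Conditioning on one trial. At \<open>k = 0\<close> truncated subtraction keeps the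
  formula right, since all tails are then \<open>1\<close>.\<close>

lemma binomial_tail_Suc:
  assumes "0 \<le> p" "p \<le> 1"
  shows "measure_pmf.prob (binomial_pmf (Suc n) p) {k..} =
    p * measure_pmf.prob (binomial_pmf n p) {k - 1..} + (1 - p) * measure_pmf.prob (binomial_pmf n p) {k..}"
proof -
  have "measure_pmf.prob (binomial_pmf (Suc n) p) {k..} =
      measure_pmf.expectation (bernoulli_pmf p) (\<lambda>b. measure_pmf.prob
        (map_pmf (\<lambda>j. (if b then 1 else 0) + j) (binomial_pmf n p)) {k..})"
    using assms unfolding map_pmf_def
    by (subst binomial_pmf_Suc, simp, subst measure_pmf_bind)
      (rule measure_pmf.measure_bind[where N = "count_space UNIV"],
        auto simp: space_subprob_algebra intro: prob_space_imp_subprob_space measure_pmf.prob_space_axioms)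
  moreover have "(+) (Suc 0) -` {k..} = {k - 1..}" "(+) 0 -` {k..} = {k..}" by auto
  ultimately show ?thesis using assms by simp
qed

text \<open>Induction through the one-trial recursion: the induction hypothesis raises the inner
  tails from \<open>p\<close> to \<open>q\<close>, and weight may then move from
  \<open>1 - p\<close> to success because the tail at \<open>k - 1\<close> is at least the tail at
  \<open>k\<close>.\<close>

lemma binomial_tail_mono:
  assumes "0 \<le> p" "p \<le> q" "q \<le> 1"
  shows "measure_pmf.prob (binomial_pmf n p) {k..} \<le> measure_pmf.prob (binomial_pmf n q) {k..}"
proof (induction n arbitrary: k)
  case (Suc n)
  let ?P = "\<lambda>p k. measure_pmf.prob (binomial_pmf n p) {k..}"
  have "?P q k \<le> ?P q (k - 1)" by (intro measure_pmf.finite_measure_mono) auto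
  then have "(q - p) * ?P q k \<le> (q - p) * ?P q (k - 1)" using assms by (intro mult_left_mono) auto
  moreover have "p * ?P p (k - 1) \<le> p * ?P q (k - 1)" "(1 - p) * ?P p k \<le> (1 - p) * ?P q k"
    using Suc assms by (auto intro!: mult_left_mono)
  ultimately show ?case
    using assms by (simp add: binomial_tail_Suc algebra_simps)
qed (use assms in \<open>simp add: binomial_pmf_0\<close>)

text \<open>Splits by the exact set \<open>S\<close> of successes among the coordinates
  \<open>e v\<close>; coordinates outside the image of \<open>e\<close> are unrestricted and
  contribute the factor \<open>1\<close>. It serves both the degree, with \<open>e\<close> naming
  the pair of \<open>u\<close> and \<open>v\<close>, and the binomial law, with \<open>e\<close> the
  identity.\<close>

lemma prob_card_Pi_bernoulli:
  assumes "finite A" "finite V" "e ` V \<subseteq> A" "inj_on e V" and w: "\<And>x. 0 \<le> w x" "\<And>x. w x \<le> 1"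
  shows "measure_pmf.prob (Pi_pmf A False (\<lambda>x. bernoulli_pmf (w x))) {f. k \<le> card {v \<in> V. f (e v)}} =
    (\<Sum>S | S \<subseteq> V \<and> k \<le> card S. \<Prod>v\<in>V. if v \<in> S then w (e v) else 1 - w (e v))"
proof -
  let ?P = "measure_pmf.prob (Pi_pmf A False (\<lambda>x. bernoulli_pmf (w x)))"
  let ?\<S> = "{S. S \<subseteq> V \<and> k \<le> card S}"
  have fin: "finite ?\<S>" using \<open>finite V\<close> by simp
  have "{f. k \<le> card {v \<in> V. f (e v)}} = (\<Union>S\<in>?\<S>. {f. {v \<in> V. f (e v)} = S})"
    by auto
  then have "?P {f. k \<le> card {v \<in> V. f (e v)}} = (\<Sum>S\<in>?\<S>. ?P {f. {v \<in> V. f (e v)} = S})"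
    using fin by (simp only:) (rule measure_pmf.finite_measure_finite_Union, auto simp: disjoint_family_on_def)
  also have "\<dots> = (\<Sum>S\<in>?\<S>. \<Prod>v\<in>V. if v \<in> S then w (e v) else 1 - w (e v))"
  proof (rule sum.cong[OF refl])
    fix S assume "S \<in> ?\<S>"
    then have S: "S \<subseteq> V" by simp
    define B where "B x = (if x \<in> e ` V then {x \<in> e ` S} else UNIV)" for x
    have mem: "e v \<in> e ` S \<longleftrightarrow> v \<in> S" if "v \<in> V" for v
      using S that assms by (auto dest: inj_onD)
    have "f \<in> Pi A B \<longleftrightarrow> (\<forall>v\<in>V. f (e v) \<longleftrightarrow> v \<in> S)" for f
      using assms(3) mem unfolding B_def Pi_def by fastforce
    then have "{f. {v \<in> V. f (e v)} = S} = Pi A B"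
      using S by blast
    then have "?P {f. {v \<in> V. f (e v)} = S} = (\<Prod>x\<in>A. measure_pmf.prob (bernoulli_pmf (w x)) (B x))"
      using measure_Pi_pmf_Pi[OF \<open>finite A\<close>] by simp
    also have "\<dots> = (\<Prod>x\<in>e ` V. measure_pmf.prob (bernoulli_pmf (w x)) (B x))"
      using assms by (intro prod.mono_neutral_right) (auto simp: B_def)
    also have "\<dots> = (\<Prod>v\<in>V. measure_pmf.prob (bernoulli_pmf (w (e v))) (B (e v)))"
      using assms by (simp add: prod.reindex)
    also have "\<dots> = (\<Prod>v\<in>V. if v \<in> S then w (e v) else 1 - w (e v))"
      using w mem by (intro prod.cong) (auto simp: B_def measure_pmf_single)
    finally show "?P {f. {v \<in> V. f (e v)} = S} = \<dots>" .
  qed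
  finally show ?thesis .
qed

text \<open>Gives the binomial tail the same shape as the degree tail below, so that the two can be
  matched summand by summand after integration; it also shows measurability in
  \<open>p\<close>.\<close>

lemma binomial_tail_eq_sum:
  assumes "finite V" "0 \<le> p" "p \<le> 1"
  shows "measure_pmf.prob (binomial_pmf (card V) p) {k..} =
    (\<Sum>S | S \<subseteq> V \<and> k \<le> card S. \<Prod>v\<in>V. if v \<in> S then p else 1 - p)"
proof -
  have "measure_pmf.prob (binomial_pmf (card V) p) {k..} =
      measure_pmf.prob (Pi_pmf V False (\<lambda>_. bernoulli_pmf p)) {f. k \<le> card {v \<in> V. f v}}"
    using assms by (subst binomial_pmf_altdef'[of V _ _ False]) (auto simp: vimage_def)
  then show ?thesis
    using prob_card_Pi_bernoulli[of V V id "\<lambda>_. p" k] assms by simp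
qed

section \<open>The degree law given the positions\<close>

lemma relative_angle_commute: "relative_angle \<theta> \<phi> = relative_angle \<phi> \<theta>"
  by (simp add: relative_angle_def abs_minus_commute)

lemma connection_prob_commute: "connection_prob N \<zeta> \<beta> p q = connection_prob N \<zeta> \<beta> q p"
  by (simp add: connection_prob_def hyp_dist_def relative_angle_commute[of "snd p"] mult_ac)

text \<open>Distinct \<open>v\<close> form distinct pairs with \<open>u\<close>, so the edges at
  \<open>u\<close> are independent. In each summand the position of any other vertex enters a single
  factor, which allows the positions to be integrated out separately later.\<close>

lemma prob_degree_ge_given_positions:
  assumes "u < N"
  shows "measure_pmf.prob (edges_given_positions N \<zeta> \<beta> x) {G. k \<le> vertex_degree N u (y, G)} =
    (\<Sum>S | S \<subseteq> {..<N} - {u} \<and> k \<le> card S. \<Prod>v\<in>{..<N} - {u}.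
       if v \<in> S then connection_prob N \<zeta> \<beta> (x u) (x v) else 1 - connection_prob N \<zeta> \<beta> (x u) (x v))"
proof -
  let ?V = "{..<N} - {u}"
  let ?e = "\<lambda>v. (min u v, max u v)"
  define w where "w = (\<lambda>(i, j). connection_prob N \<zeta> \<beta> (x i) (x j))"
  have w: "w (?e v) = connection_prob N \<zeta> \<beta> (x u) (x v)" for v
    by (auto simp: w_def min_def max_def connection_prob_commute)
  have "edges_given_positions N \<zeta> \<beta> x = Pi_pmf (vertex_pairs N) False (\<lambda>e. bernoulli_pmf (w e))"
    unfolding edges_given_positions_def w_def by (rule arg_cong[of _ _ "Pi_pmf _ _"]) auto
  moreover have "{G. k \<le> vertex_degree N u (y, G)} = {G. k \<le> card {v \<in> ?V. G (?e v)}}"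
    by (auto simp: vertex_degree_def intro!: arg_cong[of _ _ "\<lambda>A. k \<le> card A"])
  moreover have "?e ` ?V \<subseteq> vertex_pairs N" using assms by (auto simp: vertex_pairs_def)
  moreover have "inj_on ?e ?V" by (auto simp: inj_on_def min_def max_def split: if_splits)
  ultimately show ?thesis
    using prob_card_Pi_bernoulli[OF finite_vertex_pairs, of ?V ?e N w k]
    by (simp only: w) (simp add: w_def connection_prob_bounds split: prod.split)
qed

section \<open>The degree law given the type\<close>

definition mean_connection :: "nat \<Rightarrow> real \<Rightarrow> real \<Rightarrow> real \<Rightarrow> real \<times> real \<Rightarrow> real" where
  "mean_connection N \<zeta> \<alpha> \<beta> p = (\<integral>q. connection_prob N \<zeta> \<beta> p q \<partial>point_law \<alpha> (disc_radius \<zeta> N))"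

lemma prob_space_point_law:
  assumes "0 < \<alpha>" "0 < R"
  shows "prob_space (point_law \<alpha> R)"
proof -
  interpret r: prob_space "radial_measure \<alpha> R" using assms by (rule prob_space_radial_measure)
  interpret a: prob_space angle_measure by (rule prob_space_angle_measure)
  interpret pair_prob_space "radial_measure \<alpha> R" angle_measure ..
  show ?thesis unfolding point_law_def by unfold_locales
qed

lemma disc_radius_pos: "0 < \<zeta> \<Longrightarrow> 2 \<le> N \<Longrightarrow> 0 < disc_radius \<zeta> N"
  by (simp add: disc_radius_def)

text \<open>The angle \<open>0\<close> is an arbitrary representative, justified by
  \<open>mean_connection_rotate\<close>.\<close>

definition binomial_tail_of_type :: "nat \<Rightarrow> real \<Rightarrow> real \<Rightarrow> real \<Rightarrow> nat \<Rightarrow> real \<Rightarrow> real" where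
  "binomial_tail_of_type N \<zeta> \<alpha> \<beta> k t =
     measure_pmf.prob (binomial_pmf (N - 1) (mean_connection N \<zeta> \<alpha> \<beta> (disc_radius \<zeta> N - t, 0))) {k..}"

context
  fixes N :: nat and \<zeta> \<alpha> \<beta> :: real
  assumes params: "0 < \<zeta>" "0 < \<alpha>" "2 \<le> N"
begin

interpretation Q: prob_space "point_law \<alpha> (disc_radius \<zeta> N)"
  by (rule prob_space_point_law[OF params(2) disc_radius_pos[OF params(1,3)]])

interpretation PQ: product_sigma_finite "\<lambda>_. point_law \<alpha> (disc_radius \<zeta> N)"
  by standard

lemma integrable_connection_prob:
  "integrable (point_law \<alpha> (disc_radius \<zeta> N)) (connection_prob N \<zeta> \<beta> p)"
proof (rule Q.integrable_const_bound[where B = 1])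
  show "connection_prob N \<zeta> \<beta> p \<in> borel_measurable (point_law \<alpha> (disc_radius \<zeta> N))" by measurable
qed (simp add: connection_prob_bounds)

lemma nn_integral_connection_prob:
  "(\<integral>\<^sup>+q. ennreal (connection_prob N \<zeta> \<beta> p q) \<partial>point_law \<alpha> (disc_radius \<zeta> N)) = ennreal (mean_connection N \<zeta> \<alpha> \<beta> p)"
  unfolding mean_connection_def
  by (rule nn_integral_eq_integral[OF integrable_connection_prob]) (simp add: connection_prob_bounds)

lemma nn_integral_one_minus_connection_prob:
  "(\<integral>\<^sup>+q. ennreal (1 - connection_prob N \<zeta> \<beta> p q) \<partial>point_law \<alpha> (disc_radius \<zeta> N)) = ennreal (1 - mean_connection N \<zeta> \<alpha> \<beta> p)"
proof -
  have "(\<integral>\<^sup>+q. ennreal (1 - connection_prob N \<zeta> \<beta> p q) \<partial>point_law \<alpha> (disc_radius \<zeta> N)) =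
      ennreal (\<integral>q. 1 - connection_prob N \<zeta> \<beta> p q \<partial>point_law \<alpha> (disc_radius \<zeta> N))"
    using integrable_connection_prob by (intro nn_integral_eq_integral) (auto simp: connection_prob_bounds)
  also have "(\<integral>q. 1 - connection_prob N \<zeta> \<beta> p q \<partial>point_law \<alpha> (disc_radius \<zeta> N)) = 1 - mean_connection N \<zeta> \<alpha> \<beta> p"
    unfolding mean_connection_def using integrable_connection_prob
    by (subst Bochner_Integration.integral_diff) (auto simp: Q.prob_space)
  finally show ?thesis .
qed

lemma mean_connection_bounds: "0 \<le> mean_connection N \<zeta> \<alpha> \<beta> p" "mean_connection N \<zeta> \<alpha> \<beta> p \<le> 1"
  unfolding mean_connection_def
  by (simp add: connection_prob_bounds,
      rule Q.integral_le_const[OF integrable_connection_prob], simp add: connection_prob_bounds)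

lemma measurable_mean_connection [measurable]:
  "mean_connection N \<zeta> \<alpha> \<beta> \<in> borel_measurable (borel \<Otimes>\<^sub>M borel)"
  unfolding mean_connection_def by measurable

text \<open>For each radius \<open>s\<close> of the second vertex the connection probability depends
  on the angles only through the cosine of their difference, so
  \<open>nn_integral_angle_rotate\<close> applies to the inner integral.\<close>

lemma mean_connection_rotate: "mean_connection N \<zeta> \<alpha> \<beta> (r, \<theta>) = mean_connection N \<zeta> \<alpha> \<beta> (r, 0)"
proof -
  define F where "F s x = 1 / (exp (\<beta> * (\<zeta> / 2) * (arcosh (cosh (\<zeta> * r) * cosh (\<zeta> * s)
       - sinh (\<zeta> * r) * sinh (\<zeta> * s) * cos x) / \<zeta> - disc_radius \<zeta> N)) + 1)" for s x
  have F: "connection_prob N \<zeta> \<beta> (r, \<theta>) (s, \<phi>) = F s (\<theta> - \<phi>)" for \<theta> s \<phi>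
    by (simp add: connection_prob_def hyp_dist_def cos_relative_angle F_def)
  have Fm: "F s \<in> borel_measurable borel" for s unfolding F_def arcosh_def by measurable
  have rot: "(\<integral>\<^sup>+\<phi>. ennreal (F s (\<theta> - \<phi>)) \<partial>angle_measure) = (\<integral>\<^sup>+\<phi>. ennreal (F s \<phi>) \<partial>angle_measure)" for s \<theta>
    by (rule nn_integral_angle_rotate[of "\<lambda>x. ennreal (F s x)", OF measurable_compose[OF Fm measurable_ennreal]])
      (simp_all add: F_def)
  have "(\<integral>\<^sup>+q. ennreal (connection_prob N \<zeta> \<beta> (r, \<theta>) q) \<partial>point_law \<alpha> (disc_radius \<zeta> N)) =
     (\<integral>\<^sup>+q. ennreal (connection_prob N \<zeta> \<beta> (r, 0) q) \<partial>point_law \<alpha> (disc_radius \<zeta> N))"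
    by (simp only: nn_integral_point_law measurable_compose[OF measurable_connection_prob_right measurable_ennreal] F rot)
  then show ?thesis
    unfolding nn_integral_connection_prob using mean_connection_bounds by simp
qed

text \<open>The tail is a polynomial in the mean connection probability, by the sum over sets of
  successes.\<close>

lemma measurable_binomial_tail_of_type [measurable]:
  "binomial_tail_of_type N \<zeta> \<alpha> \<beta> k \<in> borel_measurable borel"
proof -
  have c: "card {..<N - 1} = N - 1" by simp
  show ?thesis
    unfolding binomial_tail_of_type_def
    by (subst c[symmetric], subst binomial_tail_eq_sum) (simp, simp add: mean_connection_bounds, simp add: mean_connection_bounds, measurable)
qed

section \<open>Integrals over the joint law of positions and graph\<close>

lemma nn_integral_hyp_random_graph:
  assumes [measurable]: "f \<in> borel_measurable (positions N \<zeta> \<alpha> \<Otimes>\<^sub>M count_space UNIV)"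
  shows "(\<integral>\<^sup>+\<omega>. f \<omega> \<partial>hyp_random_graph N \<zeta> \<alpha> \<beta>) =
    (\<integral>\<^sup>+x. \<integral>\<^sup>+G. f (x, G) \<partial>measure_pmf (edges_given_positions N \<zeta> \<beta> x) \<partial>positions N \<zeta> \<alpha>)"
  unfolding hyp_random_graph_def
  by (subst nn_integral_bind[OF assms measurable_prob_algebraD[OF measurable_graph_kernel]])
    (auto intro!: nn_integral_cong nn_integral_distr simp: space_pair_measure)

context
  fixes u :: nat
  assumes u: "u < N"
begin

lemma nn_integral_position:
  assumes [measurable]: "h \<in> borel_measurable (borel \<Otimes>\<^sub>M borel)"
  shows "(\<integral>\<^sup>+x. h (x u) \<partial>positions N \<zeta> \<alpha>) = (\<integral>\<^sup>+y. h y \<partial>point_law \<alpha> (disc_radius \<zeta> N))"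
proof -
  let ?Q = "point_law \<alpha> (disc_radius \<zeta> N)"
  have "distr (positions N \<zeta> \<alpha>) ?Q (\<lambda>x. x u) = ?Q"
    unfolding positions_def using u
    by (intro distr_PiM_component) (auto intro: Q.prob_space_axioms)
  moreover have "(\<lambda>x. x u) \<in> positions N \<zeta> \<alpha> \<rightarrow>\<^sub>M ?Q"
    unfolding positions_def using u by (intro measurable_component_singleton) simp
  moreover have "h \<in> borel_measurable ?Q" by measurable
  ultimately show ?thesis using nn_integral_distr by metis
qed

text \<open>With the position \<open>y\<close> of \<open>u\<close> held fixed, the other positions
  are independent, so every product over \<open>v\<close> integrates factor by factor and each
  connection probability is replaced by its mean. The sum over \<open>S\<close> is then again a
  binomial tail.\<close>

lemma nn_integral_degree_ge_positions:
  assumes [measurable]: "h \<in> borel_measurable (borel \<Otimes>\<^sub>M borel)"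
  shows "(\<integral>\<^sup>+x. h (x u) * ennreal (measure_pmf.prob (edges_given_positions N \<zeta> \<beta> x) {G. k \<le> vertex_degree N u (x, G)})
      \<partial>positions N \<zeta> \<alpha>) =
    (\<integral>\<^sup>+y. h y * ennreal (measure_pmf.prob (binomial_pmf (N - 1) (mean_connection N \<zeta> \<alpha> \<beta> y)) {k..})
      \<partial>point_law \<alpha> (disc_radius \<zeta> N))"
proof -
  let ?Q = "point_law \<alpha> (disc_radius \<zeta> N)"
  define V where "V = {..<N} - {u}"
  define \<S> where "\<S> = {S. S \<subseteq> V \<and> k \<le> card S}"
  define c where "c S v p q = (if v \<in> S then connection_prob N \<zeta> \<beta> p q else 1 - connection_prob N \<zeta> \<beta> p q)"
    for S :: "nat set" and v p q
  have V: "finite V" "u \<notin> V" "insert u V = {..<N}" "card V = N - 1" using u by (auto simp: V_def)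
  have c0: "0 \<le> c S v p q" for S v p q by (simp add: c_def connection_prob_bounds)
  have [measurable]: "(\<lambda>x. c S v (x u) (x v)) \<in> borel_measurable (PiM {..<N} (\<lambda>_. ?Q))" if "v \<in> V" for S v
    using measurable_connection_positions[OF u, of v \<zeta> \<beta> \<alpha>] that
    unfolding c_def positions_def V_def by auto
  have c_meas [measurable]: "c S v p \<in> borel_measurable ?Q" for S v p
    unfolding c_def by measurable
  have [measurable]: "(\<lambda>x. h (x u)) \<in> borel_measurable (PiM {..<N} (\<lambda>_. ?Q))"
    using measurable_compose[OF measurable_position[OF u] assms] unfolding positions_def .
  have inner: "(\<integral>\<^sup>+x. h y * (\<Prod>v\<in>V. ennreal (c S v y (x v))) \<partial>PiM V (\<lambda>_. ?Q)) =
      h y * (\<Prod>v\<in>V. ennreal (if v \<in> S then mean_connection N \<zeta> \<alpha> \<beta> y else 1 - mean_connection N \<zeta> \<alpha> \<beta> y))" for S y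
  proof -
    have "(\<lambda>x. \<Prod>v\<in>V. ennreal (c S v y (x v))) \<in> borel_measurable (PiM V (\<lambda>_. ?Q))"
      by measurable
    then have "(\<integral>\<^sup>+x. h y * (\<Prod>v\<in>V. ennreal (c S v y (x v))) \<partial>PiM V (\<lambda>_. ?Q)) =
        h y * (\<integral>\<^sup>+x. (\<Prod>v\<in>V. ennreal (c S v y (x v))) \<partial>PiM V (\<lambda>_. ?Q))"
      by (rule nn_integral_cmult)
    also have "(\<integral>\<^sup>+x. (\<Prod>v\<in>V. ennreal (c S v y (x v))) \<partial>PiM V (\<lambda>_. ?Q)) = (\<Prod>v\<in>V. \<integral>\<^sup>+q. ennreal (c S v y q) \<partial>?Q)"
      using V by (intro PQ.product_nn_integral_prod) auto
    also have "\<dots> = (\<Prod>v\<in>V. ennreal (if v \<in> S then mean_connection N \<zeta> \<alpha> \<beta> y else 1 - mean_connection N \<zeta> \<alpha> \<beta> y))"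
      by (intro prod.cong) (auto simp: c_def nn_integral_connection_prob nn_integral_one_minus_connection_prob)
    finally show ?thesis .
  qed
  have "(\<integral>\<^sup>+x. h (x u) * ennreal (measure_pmf.prob (edges_given_positions N \<zeta> \<beta> x) {G. k \<le> vertex_degree N u (x, G)})
      \<partial>positions N \<zeta> \<alpha>) = (\<integral>\<^sup>+x. (\<Sum>S\<in>\<S>. h (x u) * (\<Prod>v\<in>V. ennreal (c S v (x u) (x v)))) \<partial>PiM {..<N} (\<lambda>_. ?Q))"
    unfolding positions_def[symmetric] prob_degree_ge_given_positions[OF u] V_def[symmetric] \<S>_def[symmetric] c_def[symmetric]
    by (intro nn_integral_cong) (simp add: sum_distrib_left[symmetric] prod_ennreal prod_nonneg c0)
  also have "\<dots> = (\<Sum>S\<in>\<S>. \<integral>\<^sup>+x. h (x u) * (\<Prod>v\<in>V. ennreal (c S v (x u) (x v))) \<partial>PiM {..<N} (\<lambda>_. ?Q))"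
    by (rule nn_integral_sum) measurable
  also have "\<dots> = (\<Sum>S\<in>\<S>. \<integral>\<^sup>+y. h y * (\<Prod>v\<in>V. ennreal (if v \<in> S then mean_connection N \<zeta> \<alpha> \<beta> y else 1 - mean_connection N \<zeta> \<alpha> \<beta> y)) \<partial>?Q)"
  proof (rule sum.cong[OF refl])
    fix S
    \<comment> \<open>The coordinate of \<open>u\<close> is separated from the family on
      \<open>V\<close> as \<open>x(u := y)\<close>; at the vertices of \<open>V\<close> the update
      is invisible.\<close>
    have "(\<integral>\<^sup>+x. h (x u) * (\<Prod>v\<in>V. ennreal (c S v (x u) (x v))) \<partial>PiM {..<N} (\<lambda>_. ?Q)) =
        (\<integral>\<^sup>+y. \<integral>\<^sup>+x. h ((x(u := y)) u) * (\<Prod>v\<in>V. ennreal (c S v ((x(u := y)) u) ((x(u := y)) v))) \<partial>PiM V (\<lambda>_. ?Q) \<partial>?Q)"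
      unfolding V(3)[symmetric]
      by (rule PQ.product_nn_integral_insert_rev[OF V(1,2)]) (unfold V(3), measurable)
    also have "\<dots> = (\<integral>\<^sup>+y. \<integral>\<^sup>+x. h y * (\<Prod>v\<in>V. ennreal (c S v y (x v))) \<partial>PiM V (\<lambda>_. ?Q) \<partial>?Q)"
      using V(2) by (intro nn_integral_cong) (auto intro!: arg_cong2[of _ _ _ _ "(*)"] prod.cong)
    finally show "(\<integral>\<^sup>+x. h (x u) * (\<Prod>v\<in>V. ennreal (c S v (x u) (x v))) \<partial>PiM {..<N} (\<lambda>_. ?Q)) =
        (\<integral>\<^sup>+y. h y * (\<Prod>v\<in>V. ennreal (if v \<in> S then mean_connection N \<zeta> \<alpha> \<beta> y else 1 - mean_connection N \<zeta> \<alpha> \<beta> y)) \<partial>?Q)"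
      by (simp only: inner)
  qed
  also have "\<dots> = (\<integral>\<^sup>+y. (\<Sum>S\<in>\<S>. h y * (\<Prod>v\<in>V. ennreal (if v \<in> S then mean_connection N \<zeta> \<alpha> \<beta> y else 1 - mean_connection N \<zeta> \<alpha> \<beta> y))) \<partial>?Q)"
    by (rule nn_integral_sum[symmetric]) measurable
  also have "\<dots> = (\<integral>\<^sup>+y. h y * ennreal (measure_pmf.prob (binomial_pmf (N - 1) (mean_connection N \<zeta> \<alpha> \<beta> y)) {k..}) \<partial>?Q)"
    unfolding V(4)[symmetric] binomial_tail_eq_sum[OF V(1) mean_connection_bounds] \<S>_def[symmetric]
    by (intro nn_integral_cong)
      (simp add: sum_distrib_left[symmetric] prod_ennreal prod_nonneg mean_connection_bounds)
  finally show ?thesis .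
qed

lemma measurable_type_fun:
  assumes [measurable]: "g \<in> borel_measurable borel"
  shows "(\<lambda>\<omega>. g (vertex_type N \<zeta> u \<omega>)) \<in> borel_measurable (positions N \<zeta> \<alpha> \<Otimes>\<^sub>M count_space UNIV)"
  using measurable_compose[OF borel_measurable_vertex_type[OF params u] assms]
  by (subst measurable_cong_sets[OF sets_hyp_random_graph[OF params, symmetric] refl])

lemma measurable_degree: "vertex_degree N u \<in> positions N \<zeta> \<alpha> \<Otimes>\<^sub>M count_space UNIV \<rightarrow>\<^sub>M count_space UNIV"
proof -
  have "vertex_degree N u = (\<lambda>G. vertex_degree N u (undefined, G)) \<circ> snd"
    by (auto simp: vertex_degree_def)
  moreover have "(\<lambda>G. vertex_degree N u (undefined, G)) \<circ> snd \<in> positions N \<zeta> \<alpha> \<Otimes>\<^sub>M count_space UNIV \<rightarrow>\<^sub>M count_space UNIV"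
    by (rule measurable_comp[OF measurable_snd]) simp
  ultimately show ?thesis by simp
qed

text \<open>By rotation invariance the binomial tail at the position of \<open>u\<close> depends on
  the radius alone, hence is a function of the type. So the result of conditioning on the whole
  position is already the result of conditioning on the type.\<close>

lemma nn_integral_degree_ge_type:
  assumes [measurable]: "g \<in> borel_measurable borel"
  shows "(\<integral>\<^sup>+\<omega>. g (vertex_type N \<zeta> u \<omega>) * indicator {\<omega>. k \<le> vertex_degree N u \<omega>} \<omega> \<partial>hyp_random_graph N \<zeta> \<alpha> \<beta>) =
    (\<integral>\<^sup>+\<omega>. g (vertex_type N \<zeta> u \<omega>) * ennreal (binomial_tail_of_type N \<zeta> \<alpha> \<beta> k (vertex_type N \<zeta> u \<omega>)) \<partial>hyp_random_graph N \<zeta> \<alpha> \<beta>)"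
proof -
  note [measurable] = measurable_type_fun measurable_degree
  define h where "h y = g (disc_radius \<zeta> N - fst y)" for y :: "real \<times> real"
  have h [measurable]: "h \<in> borel_measurable (borel \<Otimes>\<^sub>M borel)" unfolding h_def by measurable
  have "(\<lambda>\<omega>. g (vertex_type N \<zeta> u \<omega>) * indicator {\<omega>. k \<le> vertex_degree N u \<omega>} \<omega>) \<in>
      borel_measurable (positions N \<zeta> \<alpha> \<Otimes>\<^sub>M count_space UNIV)"
    unfolding indicator_def mem_Collect_eq by measurable
  note nn_integral_hyp_random_graph[OF this]
  also have "(\<integral>\<^sup>+x. \<integral>\<^sup>+G. g (vertex_type N \<zeta> u (x, G)) * indicator {\<omega>. k \<le> vertex_degree N u \<omega>} (x, G)
        \<partial>measure_pmf (edges_given_positions N \<zeta> \<beta> x) \<partial>positions N \<zeta> \<alpha>) =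
      (\<integral>\<^sup>+x. \<integral>\<^sup>+G. h (x u) * indicator {G. k \<le> vertex_degree N u (x, G)} G
        \<partial>measure_pmf (edges_given_positions N \<zeta> \<beta> x) \<partial>positions N \<zeta> \<alpha>)"
    by (intro nn_integral_cong) (simp add: indicator_def h_def vertex_type_def)
  also have "\<dots> = (\<integral>\<^sup>+x. h (x u) * ennreal (measure_pmf.prob (edges_given_positions N \<zeta> \<beta> x) {G. k \<le> vertex_degree N u (x, G)})
      \<partial>positions N \<zeta> \<alpha>)"
    by (intro nn_integral_cong) (simp add: nn_integral_cmult measure_pmf.emeasure_eq_measure)
  also have "\<dots> = (\<integral>\<^sup>+y. h y * ennreal (measure_pmf.prob (binomial_pmf (N - 1) (mean_connection N \<zeta> \<alpha> \<beta> y)) {k..})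
      \<partial>point_law \<alpha> (disc_radius \<zeta> N))"
    by (rule nn_integral_degree_ge_positions[OF h])
  also have "\<dots> = (\<integral>\<^sup>+y. h y * ennreal (binomial_tail_of_type N \<zeta> \<alpha> \<beta> k (disc_radius \<zeta> N - fst y)) \<partial>point_law \<alpha> (disc_radius \<zeta> N))"
  proof (rule nn_integral_cong)
    fix y
    show "h y * ennreal (measure_pmf.prob (binomial_pmf (N - 1) (mean_connection N \<zeta> \<alpha> \<beta> y)) {k..}) =
        h y * ennreal (binomial_tail_of_type N \<zeta> \<alpha> \<beta> k (disc_radius \<zeta> N - fst y))"
      using mean_connection_rotate[of "fst y" "snd y"] by (simp add: binomial_tail_of_type_def)
  qed
  also have "\<dots> = (\<integral>\<^sup>+x. h (x u) * ennreal (binomial_tail_of_type N \<zeta> \<alpha> \<beta> k (disc_radius \<zeta> N - fst (x u))) \<partial>positions N \<zeta> \<alpha>)"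
    by (rule nn_integral_position[symmetric]) measurable
  also have "\<dots> = (\<integral>\<^sup>+x. \<integral>\<^sup>+G. g (vertex_type N \<zeta> u (x, G)) * ennreal (binomial_tail_of_type N \<zeta> \<alpha> \<beta> k (vertex_type N \<zeta> u (x, G)))
        \<partial>measure_pmf (edges_given_positions N \<zeta> \<beta> x) \<partial>positions N \<zeta> \<alpha>)"
    by (simp add: h_def vertex_type_def)
  also have "\<dots> = (\<integral>\<^sup>+\<omega>. g (vertex_type N \<zeta> u \<omega>) * ennreal (binomial_tail_of_type N \<zeta> \<alpha> \<beta> k (vertex_type N \<zeta> u \<omega>)) \<partial>hyp_random_graph N \<zeta> \<alpha> \<beta>)"
    by (rule nn_integral_hyp_random_graph[symmetric]) measurable
  finally show ?thesis .
qed

text \<open>Places the radius of \<open>u\<close> in \<open>[0, R]\<close>, as the asymptotic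
  estimate requires: the indicator of the complement has integral zero.\<close>

lemma AE_vertex_type:
  "AE \<omega> in hyp_random_graph N \<zeta> \<alpha> \<beta>. 0 \<le> vertex_type N \<zeta> u \<omega> \<and> vertex_type N \<zeta> u \<omega> \<le> disc_radius \<zeta> N"
proof -
  let ?R = "disc_radius \<zeta> N"
  let ?g = "\<lambda>t. indicator (- {0..?R}) t :: ennreal"
  have m: "(\<lambda>\<omega>. ?g (vertex_type N \<zeta> u \<omega>)) \<in> borel_measurable (positions N \<zeta> \<alpha> \<Otimes>\<^sub>M count_space UNIV)"
    by (rule measurable_type_fun) measurable
  have m': "(\<lambda>y. ?g (?R - fst y)) \<in> borel_measurable (borel \<Otimes>\<^sub>M borel)"
    by measurable
  have "(\<integral>\<^sup>+\<omega>. ?g (vertex_type N \<zeta> u \<omega>) \<partial>hyp_random_graph N \<zeta> \<alpha> \<beta>) = (\<integral>\<^sup>+x. ?g (?R - fst (x u)) \<partial>positions N \<zeta> \<alpha>)"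
    unfolding nn_integral_hyp_random_graph[OF m] by (simp add: vertex_type_def)
  also have "\<dots> = (\<integral>\<^sup>+s. \<integral>\<^sup>+\<phi>. ?g (?R - fst (s, \<phi>)) \<partial>angle_measure \<partial>radial_measure \<alpha> ?R)"
    unfolding nn_integral_position[OF m'] by (rule nn_integral_point_law[OF m'])
  also have "\<dots> = (\<integral>\<^sup>+s. 0 \<partial>radial_measure \<alpha> ?R)"
    using AE_radial_measure[where \<alpha> = \<alpha> and R = ?R]
    by (intro nn_integral_cong_AE) (auto elim!: eventually_mono simp: indicator_def)
  finally have "(\<integral>\<^sup>+\<omega>. ?g (vertex_type N \<zeta> u \<omega>) \<partial>hyp_random_graph N \<zeta> \<alpha> \<beta>) = 0" by simp
  moreover have "(\<lambda>\<omega>. ?g (vertex_type N \<zeta> u \<omega>)) \<in> borel_measurable (hyp_random_graph N \<zeta> \<alpha> \<beta>)"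
    using borel_measurable_vertex_type[OF params u] by measurable
  ultimately have "AE \<omega> in hyp_random_graph N \<zeta> \<alpha> \<beta>. ?g (vertex_type N \<zeta> u \<omega>) = 0"
    by (simp only: nn_integral_0_iff_AE)
  then show ?thesis by (rule eventually_mono) (auto simp: indicator_def split: if_splits)
qed

text \<open>Conditional expectation given the type is characterised by integrals over preimages of
  Borel sets \<open>C\<close>, so \<open>nn_integral_degree_ge_type\<close> is applied with
  \<open>g\<close> the indicator of \<open>C\<close>. As there are countably many \<open>k\<close>,
  one exceptional null set serves the whole law.\<close>

lemma AE_degree_tail_given_type:
  "AE \<omega> in hyp_random_graph N \<zeta> \<alpha> \<beta>. \<forall>k.
     degree_tail_given_type N \<zeta> \<alpha> \<beta> u \<omega> k = binomial_tail_of_type N \<zeta> \<alpha> \<beta> k (vertex_type N \<zeta> u \<omega>)"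
proof -
  define M where "M = hyp_random_graph N \<zeta> \<alpha> \<beta>"
  define F where "F = vimage_algebra (space M) (vertex_type N \<zeta> u) borel"
  have vt [measurable]: "vertex_type N \<zeta> u \<in> borel_measurable M"
    unfolding M_def by (rule borel_measurable_vertex_type[OF params u])
  have deg [measurable]: "vertex_degree N u \<in> M \<rightarrow>\<^sub>M count_space UNIV"
    unfolding M_def measurable_cong_sets[OF sets_hyp_random_graph[OF params] refl] by (rule measurable_degree)
  have sets_F: "sets F = {vertex_type N \<zeta> u -` C \<inter> space M |C. C \<in> sets borel}"
    unfolding F_def by (rule sets_vimage_algebra2) simp
  have sub: "subalgebra M F"
    unfolding subalgebra_def using measurable_sets[OF vt] by (auto simp: F_def[symmetric] sets_F) (simp_all add: F_def)
  interpret M: prob_space M unfolding M_def by (rule prob_space_hyp_random_graph[OF params])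
  interpret finite_measure_subalgebra M F by standard (rule sub)
  have vtF [measurable]: "vertex_type N \<zeta> u \<in> borel_measurable F"
    unfolding F_def by (rule measurable_vimage_algebra1) simp
  have "AE \<omega> in M. real_cond_exp M F (indicator {\<omega> \<in> space M. k \<le> vertex_degree N u \<omega>}) \<omega> =
      binomial_tail_of_type N \<zeta> \<alpha> \<beta> k (vertex_type N \<zeta> u \<omega>)" for k
  proof (rule real_cond_exp_charact)
    let ?D = "{\<omega> \<in> space M. k \<le> vertex_degree N u \<omega>}"
    have b: "0 \<le> binomial_tail_of_type N \<zeta> \<alpha> \<beta> k t" "binomial_tail_of_type N \<zeta> \<alpha> \<beta> k t \<le> 1" for t
      by (simp_all add: binomial_tail_of_type_def)
    have D [measurable]: "?D \<in> sets M" by measurable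
    show "integrable M (indicator ?D :: _ \<Rightarrow> real)"
      by (rule M.integrable_const_bound[where B = 1]) (auto split: split_indicator)
    show "integrable M (\<lambda>\<omega>. binomial_tail_of_type N \<zeta> \<alpha> \<beta> k (vertex_type N \<zeta> u \<omega>))"
      by (rule M.integrable_const_bound[where B = 1]) (use b in auto)
    show "(\<lambda>\<omega>. binomial_tail_of_type N \<zeta> \<alpha> \<beta> k (vertex_type N \<zeta> u \<omega>)) \<in> borel_measurable F"
      by measurable
    fix A assume "A \<in> sets F"
    then obtain C where [measurable]: "C \<in> sets borel" and A: "A = vertex_type N \<zeta> u -` C \<inter> space M"
      unfolding sets_F by auto
    have Am [measurable]: "A \<in> sets M" unfolding A by measurable
    have "(\<integral>\<omega>\<in>A. indicator ?D \<omega> \<partial>M) = enn2real (\<integral>\<^sup>+\<omega>. ennreal (indicator A \<omega> *\<^sub>R indicator ?D \<omega>) \<partial>M)"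
      unfolding set_lebesgue_integral_def by (rule integral_eq_nn_integral) auto
    also have "(\<integral>\<^sup>+\<omega>. ennreal (indicator A \<omega> *\<^sub>R indicator ?D \<omega>) \<partial>M) =
        (\<integral>\<^sup>+\<omega>. indicator C (vertex_type N \<zeta> u \<omega>) * indicator {\<omega>. k \<le> vertex_degree N u \<omega>} \<omega> \<partial>M)"
      by (intro nn_integral_cong) (auto simp: A indicator_def)
    also have "\<dots> = (\<integral>\<^sup>+\<omega>. indicator C (vertex_type N \<zeta> u \<omega>) * ennreal (binomial_tail_of_type N \<zeta> \<alpha> \<beta> k (vertex_type N \<zeta> u \<omega>)) \<partial>M)"
      unfolding M_def by (rule nn_integral_degree_ge_type) measurable
    also have "\<dots> = (\<integral>\<^sup>+\<omega>. ennreal (indicator A \<omega> *\<^sub>R binomial_tail_of_type N \<zeta> \<alpha> \<beta> k (vertex_type N \<zeta> u \<omega>)) \<partial>M)"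
      by (intro nn_integral_cong) (auto simp: A indicator_def)
    also have "enn2real \<dots> = (\<integral>\<omega>\<in>A. binomial_tail_of_type N \<zeta> \<alpha> \<beta> k (vertex_type N \<zeta> u \<omega>) \<partial>M)"
      unfolding set_lebesgue_integral_def by (rule integral_eq_nn_integral[symmetric]) (use b in auto)
    finally show "(\<integral>\<omega>\<in>A. indicator ?D \<omega> \<partial>M) = (\<integral>\<omega>\<in>A. binomial_tail_of_type N \<zeta> \<alpha> \<beta> k (vertex_type N \<zeta> u \<omega>) \<partial>M)" .
  qed
  then show ?thesis
    unfolding degree_tail_given_type_def Let_def M_def[symmetric] F_def[symmetric] by (simp add: AE_all_countable)
qed

end

end

section \<open>Asymptotics of the mean connection probability\<close>

lemma filterlim_disc_radius:
  assumes "0 < \<zeta>"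
  shows "filterlim (disc_radius \<zeta>) at_top sequentially"
  unfolding disc_radius_def using assms by real_asymp

text \<open>The errors are constants to be compared with \<open>\<zeta> / 2 * r\<close>, and the
  lower bound on \<open>r\<close> tends to infinity with \<open>N\<close>, which makes the estimate
  uniform; the moment generating functions involve \<open>N\<close> but not \<open>r\<close>. The
  last conclusion, from the decay of \<open>r * exp (- (\<zeta> / 2 * r))\<close>, makes the upper
  parameter a probability.\<close>

lemma mean_connection_asymp:
  assumes "0 < \<zeta>" "0 < \<alpha>" "\<zeta> / 2 < \<alpha>" "0 < \<epsilon>"
    and K: "K = 1 / pi * (2 * \<alpha> * \<zeta> / (2 * \<alpha> - \<zeta>))"
  shows "\<forall>\<^sub>F N in sequentially. \<forall>r \<theta>.
    (1 - \<zeta> / (2 * \<alpha>)) * disc_radius \<zeta> N \<le> r \<longrightarrow> r \<le> disc_radius \<zeta> N \<longrightarrow>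
    (1 - \<epsilon>) * (r * (K * exp (- (\<zeta> / 2 * r)))) \<le> mean_connection N \<zeta> \<alpha> 1 (r, \<theta>) \<and>
    mean_connection N \<zeta> \<alpha> 1 (r, \<theta>) \<le> (1 + \<epsilon>) * (r * (K * exp (- (\<zeta> / 2 * r)))) \<and>
    (1 + \<epsilon>) * (r * (K * exp (- (\<zeta> / 2 * r)))) \<le> 1"
proof -
  define b where "b = \<zeta> / 2"
  \<comment> \<open>The midpoint of \<open>b\<close> and \<open>\<alpha>\<close> is an admissible
    exponent for \<open>mean_connection_ge\<close>.\<close>
  define c where "c = (\<alpha> + b) / 2"
  define L where "L = \<alpha> / (\<alpha> - b)"
  define L' where "L' = \<alpha> / (\<alpha> - c)"
  define C where "C = b / (c - b) * (L' + 1)"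
  \<comment> \<open>Chosen so that \<open>(1 + \<eta>)^2 \<le> 1 + \<epsilon>\<close>, which uses
    \<open>\<eta> \<le> 1\<close>, and
    \<open>(1 - \<eta>)^2 - \<eta> \<ge> 1 - \<epsilon>\<close>.\<close>
  define \<eta> where "\<eta> = min 1 (\<epsilon> / 3)"
  define \<gamma> where "\<gamma> = 1 - \<zeta> / (2 * \<alpha>)"
  have b: "0 < b" "b < c" "c < \<alpha>" using assms by (auto simp: b_def c_def)
  have L: "L > 0" "L' > 0" using b assms by (auto simp: L_def L'_def)
  have C: "C \<ge> 0" using b L by (simp add: C_def)
  have \<eta>: "0 < \<eta>" "\<eta> \<le> 1" "3 * \<eta> \<le> \<epsilon>" using assms by (auto simp: \<eta>_def)
  have \<gamma>: "\<gamma> > 0" using assms by (simp add: \<gamma>_def field_simps)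
  \<comment> \<open>The constant \<open>K\<close> explained: \<open>2 / pi\<close> comes from the
    angle, \<open>b\<close> from the logarithm and \<open>L\<close> from the type.\<close>
  have KL: "K = 2 / pi * b * L"
    unfolding K L_def b_def using assms by (simp add: field_simps)
  have "((\<lambda>r. (1 + \<epsilon>) * (r * (K * exp (- (b * r))))) \<longlongrightarrow> 0) at_top"
    using b by real_asymp
  then have "\<forall>\<^sub>F r in at_top. (1 + \<epsilon>) * (r * (K * exp (- (b * r)))) < 1"
    by (rule order_tendstoD) simp
  moreover have "\<forall>\<^sub>F r in at_top. r \<ge> max (3 / (\<eta> * b)) (C / (\<eta> * b * L))"
    by (rule eventually_ge_at_top)
  \<comment> \<open>Beyond \<open>r0\<close> the constants \<open>2\<close> and \<open>3\<close> are
    at most \<open>\<eta> * b * r\<close>, and the error \<open>C\<close> is at most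
    \<open>\<eta> * b * r * L\<close>.\<close>
  ultimately obtain r0 where r0: "\<And>r. r \<ge> r0 \<Longrightarrow> (1 + \<epsilon>) * (r * (K * exp (- (b * r)))) < 1 \<and>
      r \<ge> max (3 / (\<eta> * b)) (C / (\<eta> * b * L))"
    using eventually_conj unfolding eventually_at_top_linorder by (metis (no_types, lifting) linorder_le_cases order.trans)
  note lim = filterlim_disc_radius[OF assms(1)]
  have Mb: "(\<lambda>N. radial_mgf \<alpha> b (disc_radius \<zeta> N)) \<longlonglongrightarrow> L"
    unfolding L_def using b by (intro filterlim_compose[OF tendsto_radial_mgf lim]) auto
  have Mc: "(\<lambda>N. radial_mgf \<alpha> c (disc_radius \<zeta> N)) \<longlonglongrightarrow> L'"
    unfolding L'_def using b by (intro filterlim_compose[OF tendsto_radial_mgf lim]) auto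
  have "\<forall>\<^sub>F N in sequentially. radial_mgf \<alpha> b (disc_radius \<zeta> N) < (1 + \<eta>) * L"
    using L \<eta> by (intro order_tendstoD(2)[OF Mb]) auto
  moreover have "\<forall>\<^sub>F N in sequentially. (1 - \<eta>) * L < radial_mgf \<alpha> b (disc_radius \<zeta> N)"
    using L \<eta> by (intro order_tendstoD(1)[OF Mb]) auto
  moreover have "\<forall>\<^sub>F N in sequentially. radial_mgf \<alpha> c (disc_radius \<zeta> N) < L' + 1"
    by (intro order_tendstoD(2)[OF Mc]) auto
  moreover have "\<forall>\<^sub>F N in sequentially. r0 / \<gamma> \<le> disc_radius \<zeta> N"
    using lim by (simp add: filterlim_at_top)
  moreover have "\<forall>\<^sub>F N in sequentially. 2 \<le> N" by (rule eventually_ge_at_top)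
  ultimately show ?thesis
  proof eventually_elim
    case (elim N)
    define R where "R = disc_radius \<zeta> N"
    define X where "X = radial_mgf \<alpha> b R"
    define Y where "Y = radial_mgf \<alpha> c R"
    have R: "R > 0" using assms elim disc_radius_pos by (simp add: R_def)
    show ?case
    proof (intro allI impI)
      fix r \<theta> assume "(1 - \<zeta> / (2 * \<alpha>)) * disc_radius \<zeta> N \<le> r" and rR: "r \<le> disc_radius \<zeta> N"
      then have rg: "\<gamma> * R \<le> r" "r \<le> R" by (auto simp: R_def \<gamma>_def)
      have "r0 \<le> \<gamma> * R" using elim(4) \<gamma> by (simp add: R_def field_simps)
      then have "r0 \<le> r" using rg by linarith
      note r = r0[OF this]
      have r_pos: "0 \<le> r" using rg \<gamma> R by (smt (verit) mult_pos_pos)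
      have br3: "3 \<le> \<eta> * (b * r)" and brC: "C \<le> \<eta> * (b * r) * L"
        using r b \<eta> L by (auto simp: field_simps)
      have "\<eta> * (b * r) \<le> 1 * (b * r)" using \<eta> b r_pos by (intro mult_right_mono) auto
      then have br: "3 \<le> b * r" using br3 by simp
      define m where "m = mean_connection N \<zeta> \<alpha> 1 (r, \<theta>)"
      have m0: "m \<ge> 0" unfolding m_def using mean_connection_bounds[of \<zeta> \<alpha> N] assms elim by auto
      have nn: "(\<integral>\<^sup>+q. ennreal (connection_prob N \<zeta> 1 (r, \<theta>) q) \<partial>point_law \<alpha> (disc_radius \<zeta> N)) = ennreal m"
        unfolding m_def using assms elim by (intro nn_integral_connection_prob) auto
      have X: "(1 - \<eta>) * L \<le> X" "X \<le> (1 + \<eta>) * L" and Y: "Y \<le> L' + 1"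
        using elim by (auto simp: X_def Y_def R_def)
      have X0: "0 \<le> X" using X(1) \<eta> L by (smt (verit) mult_nonneg_nonneg)
      define E where "E = 2 / pi * exp (- (b * r))"
      have E: "E > 0" by (simp add: E_def)
      \<comment> \<open>The target shares the factor \<open>E\<close> with both mean bounds, so only
        \<open>b * r * L\<close> is left to compare.\<close>
      have q: "r * (K * exp (- (b * r))) = E * (b * r * L)"
        unfolding KL E_def by simp
      have "ennreal m \<le> ennreal (2 / pi * (b * r + 3) * exp (- (b * r)) * X)"
        using mean_connection_le[of \<zeta> \<alpha> N "(r, \<theta>)"] assms elim r_pos rR
        unfolding nn by (simp add: X_def R_def b_def)
      also have "2 / pi * (b * r + 3) * exp (- (b * r)) * X = E * ((b * r + 3) * X)"
        by (simp only: E_def mult_ac)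
      finally have "m \<le> E * ((b * r + 3) * X)"
        using X0 br E by (subst (asm) ennreal_le_iff) auto
      also have "\<dots> \<le> E * ((1 + \<epsilon>) * (b * r * L))"
      proof (rule mult_left_mono)
        \<comment> \<open>One factor \<open>1 + \<eta>\<close> pays for the \<open>3\<close>, the
          other for replacing \<open>X\<close> by its limit \<open>L\<close>.\<close>
        have "(b * r + 3) * X \<le> ((1 + \<eta>) * (b * r)) * ((1 + \<eta>) * L)"
          using X X0 br br3 by (intro mult_mono) (auto simp: algebra_simps)
        also have "\<dots> = ((1 + \<eta>) * (1 + \<eta>)) * (b * r * L)" by simp
        also have "\<dots> \<le> (1 + \<epsilon>) * (b * r * L)"
        proof (rule mult_right_mono)
          have "\<eta> * \<eta> \<le> \<eta> * 1" using \<eta> by (intro mult_left_mono) auto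
          moreover have "(1 + \<eta>) * (1 + \<eta>) = 1 + 2 * \<eta> + \<eta> * \<eta>" by (simp add: algebra_simps)
          ultimately show "(1 + \<eta>) * (1 + \<eta>) \<le> 1 + \<epsilon>" using \<eta> by linarith
        qed (use br L in auto)
        finally show "(b * r + 3) * X \<le> (1 + \<epsilon>) * (b * r * L)" .
      qed (use E in simp)
      finally have upper: "m \<le> (1 + \<epsilon>) * (E * (b * r * L))" by (simp add: mult_ac)
      have "E * ((b * r - 2) * X) = 2 / pi * (b * r - 2) * exp (- (b * r)) * X"
        "E * (b / (c - b) * Y) = 2 / pi * (b / (c - b)) * exp (- (b * r)) * Y"
        by (simp_all only: E_def mult_ac)
      then have "ennreal (E * ((b * r - 2) * X)) \<le> ennreal m + ennreal (E * (b / (c - b) * Y))"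
        using mean_connection_ge[of \<zeta> \<alpha> c N "(r, \<theta>)"] assms(1,2) elim(5) r_pos rR b br
        unfolding nn b_def[symmetric] X_def Y_def R_def by simp
      also have "\<dots> \<le> ennreal m + ennreal (E * C)"
        using Y E b unfolding C_def by (intro add_left_mono ennreal_leI mult_left_mono) auto
      also have "\<dots> = ennreal (m + E * C)" using m0 E C by (simp add: ennreal_plus)
      finally have low: "E * ((b * r - 2) * X) \<le> m + E * C"
        using m0 E C by (subst (asm) ennreal_le_iff) auto
      have "E * ((1 - \<epsilon>) * (b * r * L)) \<le> E * ((b * r - 2) * X - C)"
      proof (rule mult_left_mono)
        have "((1 - \<eta>) * (b * r)) * ((1 - \<eta>) * L) \<le> (b * r - 2) * X"
          using X \<eta> L br br3 by (intro mult_mono) (auto simp: algebra_simps)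
        then have "(1 - \<eta>) * (1 - \<eta>) * (b * r * L) - \<eta> * (b * r * L) \<le> (b * r - 2) * X - C"
          using brC by (simp add: mult_ac)
        moreover have "(1 - \<epsilon>) * (b * r * L) \<le> ((1 - \<eta>) * (1 - \<eta>) - \<eta>) * (b * r * L)"
        proof (rule mult_right_mono)
          have "0 \<le> \<eta> * \<eta>" by simp
          moreover have "(1 - \<eta>) * (1 - \<eta>) = 1 - 2 * \<eta> + \<eta> * \<eta>" by (simp add: algebra_simps)
          ultimately show "1 - \<epsilon> \<le> (1 - \<eta>) * (1 - \<eta>) - \<eta>" using \<eta> by linarith
        qed (use br L in auto)
        ultimately show "(1 - \<epsilon>) * (b * r * L) \<le> (b * r - 2) * X - C"
          using left_diff_distrib[of "(1 - \<eta>) * (1 - \<eta>)" \<eta> "b * r * L"] by linarith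
      qed (use E in simp)
      then have lower: "(1 - \<epsilon>) * (E * (b * r * L)) \<le> m"
        using low by (simp add: right_diff_distrib mult.left_commute)
      show "(1 - \<epsilon>) * (r * (K * exp (- (\<zeta> / 2 * r)))) \<le> mean_connection N \<zeta> \<alpha> 1 (r, \<theta>) \<and>
          mean_connection N \<zeta> \<alpha> 1 (r, \<theta>) \<le> (1 + \<epsilon>) * (r * (K * exp (- (\<zeta> / 2 * r)))) \<and>
          (1 + \<epsilon>) * (r * (K * exp (- (\<zeta> / 2 * r)))) \<le> 1"
        using upper lower r unfolding b_def[symmetric] q m_def[symmetric] by simp
    qed
  qed
qed

section \<open>Transfer to the conditional law of the degree\<close>

theorem theorem1p3:
  fixes \<zeta> \<alpha> \<beta> \<epsilon> K :: real
  assumes "0 < \<zeta>" and "\<zeta> < 2" and "0 < \<alpha>"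
    and "\<beta> = 1"
    and "0 < \<zeta> / \<alpha>" and "\<zeta> / \<alpha> < 2"
    and "0 < \<epsilon>"
    and "K = 1 / pi * (2 * \<alpha> * \<zeta> / (2 * \<alpha> - \<zeta>))"
  shows "\<forall>\<^sub>F N in sequentially. \<forall>u<N.
           AE \<omega> in hyp_random_graph N \<zeta> \<alpha> \<beta>.
             vertex_type N \<zeta> u \<omega> \<le> \<zeta> * disc_radius \<zeta> N / (2 * \<alpha>) \<longrightarrow>
             approx_binomial (degree_tail_given_type N \<zeta> \<alpha> \<beta> u \<omega>) \<epsilon> (N - 1)
               ((disc_radius \<zeta> N - vertex_type N \<zeta> u \<omega>) *
                (K * exp (\<zeta> * vertex_type N \<zeta> u \<omega> / 2) / real N))"
proof -
  have \<zeta>\<alpha>: "\<zeta> / 2 < \<alpha>" using assms by (simp add: field_simps)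
  have K: "K > 0" using assms \<zeta>\<alpha> by simp
  from mean_connection_asymp[OF assms(1,3) \<zeta>\<alpha> assms(7,8)] eventually_ge_at_top[of 2]
  show ?thesis
  proof eventually_elim
    case (elim N)
    show ?case
    proof (intro allI impI)
      fix u assume "u < N"
      note params = \<open>0 < \<zeta>\<close> \<open>0 < \<alpha>\<close> \<open>2 \<le> N\<close> \<open>u < N\<close>
      from AE_vertex_type[OF params, of \<beta>] AE_degree_tail_given_type[OF params, of \<beta>]
      show "AE \<omega> in hyp_random_graph N \<zeta> \<alpha> \<beta>.
             vertex_type N \<zeta> u \<omega> \<le> \<zeta> * disc_radius \<zeta> N / (2 * \<alpha>) \<longrightarrow>
             approx_binomial (degree_tail_given_type N \<zeta> \<alpha> \<beta> u \<omega>) \<epsilon> (N - 1)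
               ((disc_radius \<zeta> N - vertex_type N \<zeta> u \<omega>) *
                (K * exp (\<zeta> * vertex_type N \<zeta> u \<omega> / 2) / real N))"
      proof eventually_elim
        case (elim \<omega>)
        define t where "t = vertex_type N \<zeta> u \<omega>"
        define r where "r = disc_radius \<zeta> N - t"
        define q where "q = r * (K * exp (\<zeta> * t / 2) / real N)"
        define m where "m = mean_connection N \<zeta> \<alpha> 1 (r, 0)"
        \<comment> \<open>This turns the parameter of the statement into a function of the radius
          alone.\<close>
        have "real N = exp (\<zeta> / 2 * disc_radius \<zeta> N)"
          using assms params by (simp add: disc_radius_def)
        then have "exp (\<zeta> * t / 2) / real N = exp (- (\<zeta> / 2 * r))"
          by (simp add: r_def exp_diff[symmetric] right_diff_distrib diff_divide_distrib)
        then have q: "q = r * (K * exp (- (\<zeta> / 2 * r)))"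
          unfolding q_def by (metis times_divide_eq_right)
        have tail: "degree_tail_given_type N \<zeta> \<alpha> \<beta> u \<omega> k = measure_pmf.prob (binomial_pmf (N - 1) m) {k..}" for k
          using elim(2) params assms(4)
          by (simp add: binomial_tail_of_type_def m_def r_def t_def)
        have m: "0 \<le> m" "m \<le> 1" unfolding m_def using mean_connection_bounds[OF params(1-3)] by auto
        show ?case
        proof
          assume "vertex_type N \<zeta> u \<omega> \<le> \<zeta> * disc_radius \<zeta> N / (2 * \<alpha>)"
          \<comment> \<open>The bound on the type is the lower bound on the radius; the upper one is
            \<open>t \<ge> 0\<close>.\<close>
          then have "(1 - \<zeta> / (2 * \<alpha>)) * disc_radius \<zeta> N \<le> r" "r \<le> disc_radius \<zeta> N"
            using elim(1) by (auto simp: r_def t_def algebra_simps)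
          then have *: "(1 - \<epsilon>) * q \<le> m" "m \<le> (1 + \<epsilon>) * q" "(1 + \<epsilon>) * q \<le> 1"
            using \<open>\<forall>r \<theta>. _\<close> unfolding q m_def by auto
          have "0 \<le> q" using elim(1) K by (simp add: q r_def t_def)
          \<comment> \<open>For \<open>\<epsilon> > 1\<close> the lower parameter may be cut off at
            \<open>0\<close>, which \<open>m \<ge> 0\<close> covers; otherwise the bounds on
            \<open>m\<close> pass to the tails by monotonicity.\<close>
          then have "approx_binomial (degree_tail_given_type N \<zeta> \<alpha> \<beta> u \<omega>) \<epsilon> (N - 1) q"
            unfolding approx_binomial_def tail using * m by (auto intro!: binomial_tail_mono)
          then show "approx_binomial (degree_tail_given_type N \<zeta> \<alpha> \<beta> u \<omega>) \<epsilon> (N - 1)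
               ((disc_radius \<zeta> N - vertex_type N \<zeta> u \<omega>) *
                (K * exp (\<zeta> * vertex_type N \<zeta> u \<omega> / 2) / real N))"
            by (simp add: q_def r_def t_def)
        qed
      qed
    qed
  qed
qed

end
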